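(* Let $N_1,\dots,N_k\ge 1$ be integers, $\mathbf N=(N_1,\dots,N_k)$, and $L\in\{1,2,\dots,\max(N_1,\dots,N_k)\}$. Define $$F_{\mathbf N}(z)=\sum_{m=0}^\infty\Big(\prod_{j=1}^k\frac{(N_jm)!}{m!^{N_j}}\Big)z^m,\qquad G_{L,\mathbf N}(z)=\sum_{m=1}^\infty H_{Lm}\Big(\prod_{j=1}^k\frac{(N_jm)!}{m!^{N_j}}\Big)z^m,$$ $q_{L,\mathbf N}(z)=\exp\big(G_{L,\mathbf N}(z)/F_{\mathbf N}(z)\big)$, $M_{\mathbf N}=\prod_{i=1}^k N_i!$, and let $\Theta_L$ be the denominator of $H_L$ written as a reduced fraction. Then $q_{L,\mathbf N}(z)^{\Theta_L/M_{\mathbf N}}\in\mathbb{Z}[[z]]$.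
   Context: $H_n=\sum_{i=1}^n1/i$. For $f\in 1+z\mathbb{Q}[[z]]$ and rational $c$, $f^c$ denotes the formal power series $\exp(c\log f)$; here $q_{L,\mathbf N}^{c}=\exp\big(c\,G_{L,\mathbf N}/F_{\mathbf N}\big)$. *)

theory Defs
  imports "HOL-Computational_Algebra.Computational_Algebra"
begin

(* The library's harm lives in real normed fields, which excludes rat. *)
definition harmonic_rat :: "nat \<Rightarrow> rat" where
  "harmonic_rat n = (\<Sum>i=1..n. 1 / of_nat i)"

(* The tuple (N_1, ..., N_k) is the restriction of N to {1..k}. *)
definition fact_ratio :: "nat \<Rightarrow> (nat \<Rightarrow> nat) \<Rightarrow> nat \<Rightarrow> rat" where
  "fact_ratio k N m = (\<Prod>j=1..k. fact (N j * m) / fact m ^ N j)"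

definition F_series :: "nat \<Rightarrow> (nat \<Rightarrow> nat) \<Rightarrow> rat fps" where
  "F_series k N = Abs_fps (\<lambda>m. fact_ratio k N m)"

(* The coefficient at m = 0 vanishes because harmonic_rat 0 = 0. *)
definition G_series :: "nat \<Rightarrow> nat \<Rightarrow> (nat \<Rightarrow> nat) \<Rightarrow> rat fps" where
  "G_series L k N = Abs_fps (\<lambda>m. harmonic_rat (L * m) * fact_ratio k N m)"

(* exp f; meaningful when f has constant coefficient 0, as composition with (oo) requires. *)
definition fps_exp_of :: "rat fps \<Rightarrow> rat fps" where
  "fps_exp_of f = fps_exp 1 oo f"

(* log f, using that fps_ln 1 is the series of log (1 + z);
   meaningful when f has constant coefficient 1. *)
definition fps_log_of :: "rat fps \<Rightarrow> rat fps" where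
  "fps_log_of f = fps_ln 1 oo (f - 1)"

(* f^c = exp (c log f), for f with constant coefficient 1. *)
definition fps_rat_power :: "rat fps \<Rightarrow> rat \<Rightarrow> rat fps" where
  "fps_rat_power f c = fps_exp_of (fps_const c * fps_log_of f)"

definition q_series :: "nat \<Rightarrow> nat \<Rightarrow> (nat \<Rightarrow> nat) \<Rightarrow> rat fps" where
  "q_series L k N = fps_exp_of (G_series L k N / F_series k N)"

definition M_const :: "nat \<Rightarrow> (nat \<Rightarrow> nat) \<Rightarrow> nat" where
  "M_const k N = (\<Prod>i=1..k. fact (N i))"

definition Theta :: "nat \<Rightarrow> int" where
  "Theta L = snd (quotient_of (harmonic_rat L))"

end

(*
  Work one prime p at a time. By the Dieudonne-Dwork criterion, exp f is p-integral as soon as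
  f(z^p) - p f(z) has coefficients divisible by p. For f = (Theta_L / M) G / F and A = fact_ratio this
  reduces, in degree a + pK with a < p, to the divisibility by p of
    (Theta_L / M) * sum over j of A(a + pj) A(K - j) (p H_{L(a + pj)} - H_{L(K - j)}).
  Replacing p H_{L(a + pj)} by H_{Lj} costs a multiple of p because A(x) / M is a multiple of
  prod_{n <= L} binom(nx - 1, x - 1), which absorbs the denominators of p H_{Lx} - H_{L(x div p)};
  only for x = 1 is Theta_L needed. What is left is antisymmetric in j and K - j. Expanding H_{Lj} along
  the base-p blocks containing j and summing by parts leaves block sums, to which Dwork's formal congruences apply;
  these hold since A(v + pu) / A(u), as a function of u, gains one power of p over the
  congruence of its arguments.
*)
theory Submission
  imports Defs "HOL-Number_Theory.Number_Theory"
begin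

section \<open>Rationals that are integral at a prime\<close>

text \<open>The constant Theta_L / M need not be p-integral, and the H_{Lj} have unbounded powers of
  p in their denominators, so the terms of the antisymmetric sum need not be integral one by one.
  Splitting H_{Lj} along blocks isolates the denominators: the increment belonging to block m at
  level s becomes integral after multiplication by p^s A(m) Theta_L / M. Hence the modulus of the
  congruences has to be p^(s+1) A(m), with A(m) itself in it: p^s and A(m) are spent on the
  increment, the last p on the division that the criterion demands. This also explains the extra
  power of p asked of A(v + pu) / A(u): each induction step divides a difference by p and must stay
  within the same class of functions. Index 0 is exceptional, since A(0) = 1 is in general no
  multiple of M, but it does no harm because H_0 = 0. Everything happens among rationals with
  denominator prime to p; no completion enters.\<close>

locale localization =
  fixes p :: nat
  assumes prime_p: "prime p"
begin

definition Zp :: "rat set" where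
  "Zp = {x. \<exists>a b :: int. \<not> int p dvd b \<and> x = of_int a / of_int b}"

lemma p_pos: "p > 0"
  using prime_p by (simp add: prime_gt_0_nat)

lemma p_ge_2: "p \<ge> 2"
  using prime_p by (simp add: prime_ge_2_nat)

lemma prime_int_p: "prime (int p)"
  using prime_p by simp

lemma Zp_of_int [intro, simp]: "of_int a \<in> Zp"
  unfolding Zp_def using prime_int_p not_prime_unit
  by (intro CollectI exI[of _ a] exI[of _ 1]) auto

lemma Zp_of_nat [intro, simp]: "of_nat a \<in> Zp"
  using Zp_of_int[of "int a"] by simp

lemma Zp_0 [intro, simp]: "0 \<in> Zp"
  using Zp_of_nat[of 0] by simp

lemma Zp_1 [intro, simp]: "1 \<in> Zp"
  using Zp_of_nat[of 1] by simp

lemma Zp_add [intro]: "x \<in> Zp \<Longrightarrow> y \<in> Zp \<Longrightarrow> x + y \<in> Zp"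
proof -
  assume "x \<in> Zp" "y \<in> Zp"
  then obtain a b c d :: int where *: "\<not> int p dvd b" "x = of_int a / of_int b"
      "\<not> int p dvd d" "y = of_int c / of_int d"
    unfolding Zp_def by blast
  then have "b \<noteq> 0" "d \<noteq> 0" by auto
  with * have "x + y = of_int (a * d + c * b) / of_int (b * d)"
    by (simp add: field_simps)
  moreover have "\<not> int p dvd b * d"
    using * prime_int_p by (simp add: prime_dvd_mult_iff)
  ultimately show ?thesis unfolding Zp_def by blast
qed

lemma Zp_mult [intro]: "x \<in> Zp \<Longrightarrow> y \<in> Zp \<Longrightarrow> x * y \<in> Zp"
proof -
  assume "x \<in> Zp" "y \<in> Zp"
  then obtain a b c d :: int where *: "\<not> int p dvd b" "x = of_int a / of_int b"
      "\<not> int p dvd d" "y = of_int c / of_int d"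
    unfolding Zp_def by blast
  then have "x * y = of_int (a * c) / of_int (b * d)"
    by simp
  moreover have "\<not> int p dvd b * d"
    using * prime_int_p by (simp add: prime_dvd_mult_iff)
  ultimately show ?thesis unfolding Zp_def by blast
qed

lemma Zp_uminus [intro]: "x \<in> Zp \<Longrightarrow> - x \<in> Zp"
  using Zp_mult[OF Zp_of_int[of "- 1"], of x] by simp

lemma Zp_diff [intro]: "x \<in> Zp \<Longrightarrow> y \<in> Zp \<Longrightarrow> x - y \<in> Zp"
  using Zp_add[of x "- y"] Zp_uminus[of y] by simp

lemma Zp_sum [intro]: "(\<And>i. i \<in> I \<Longrightarrow> f i \<in> Zp) \<Longrightarrow> sum f I \<in> Zp"
  by (induction I rule: infinite_finite_induct) auto

lemma Zp_prod [intro]: "(\<And>i. i \<in> I \<Longrightarrow> f i \<in> Zp) \<Longrightarrow> prod f I \<in> Zp"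
  by (induction I rule: infinite_finite_induct) auto

lemma Zp_power [intro]: "x \<in> Zp \<Longrightarrow> x ^ n \<in> Zp"
  by (induction n) auto

lemma Zp_inverse_of_int: "\<not> int p dvd b \<Longrightarrow> 1 / of_int b \<in> Zp"
  unfolding Zp_def by (intro CollectI exI[of _ 1] exI[of _ b]) auto

lemma Zp_inverse_of_nat: "\<not> p dvd b \<Longrightarrow> 1 / of_nat b \<in> Zp"
  using Zp_inverse_of_int[of "int b"] by simp

lemma Zp_divide_dvd:
  assumes "(a :: nat) dvd b"
  shows "of_nat b / of_nat a \<in> Zp"
  using assms by (auto elim!: dvdE simp: divide_simps)

lemma Zp_cong_int: "[a = b] (mod int p ^ t) \<Longrightarrow> (of_int a - of_int b) / of_nat p ^ t \<in> Zp"
proof -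
  assume "[a = b] (mod int p ^ t)"
  then obtain c where "a - b = int p ^ t * c"
    by (auto simp: cong_iff_dvd_diff)
  then have "(of_int a - of_int b :: rat) = of_int (int p ^ t * c)"
    by (metis of_int_diff)
  then have "(of_int a - of_int b :: rat) / of_nat p ^ t = of_int c"
    using p_pos by simp
  then show ?thesis by simp
qed

lemma fermat_int: "[a ^ p = a] (mod int p)"
proof -
  define n where "n = nat (a mod int p)"
  have n: "[a = int n] (mod int p)"
    using p_pos by (simp add: n_def cong_def)
  have "[n ^ p = n] (mod p)"
  proof (cases "p dvd n")
    case True
    then have "p dvd n ^ p" using p_pos by (simp add: prime_dvd_power_iff prime_p)
    then show ?thesis using True by (simp add: cong_def mod_eq_0_iff_dvd)
  next
    case False
    then have "[n * n ^ (p - 1) = n * 1] (mod p)"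
      using fermat_theorem[OF prime_p False] by (intro cong_mult cong_refl)
    moreover have "n * n ^ (p - 1) = n ^ p"
      using p_pos by (simp add: power_eq_if)
    ultimately show ?thesis by simp
  qed
  then have "[int n ^ p = int n] (mod int p)"
    using cong_int_iff[of "n ^ p" n p] by simp
  then show ?thesis
    using n by (meson cong_pow cong_sym cong_trans)
qed

lemma Zp_fermat:
  assumes "x \<in> Zp"
  shows "(x ^ p - x) / of_nat p \<in> Zp"
proof -
  obtain a b :: int where ab: "\<not> int p dvd b" "x = of_int a / of_int b"
    using assms unfolding Zp_def by blast
  then have "b \<noteq> 0" by auto
  have "[a ^ p * b = a * b] (mod int p)" "[a * b = a * b ^ p] (mod int p)"
    using fermat_int[of a] fermat_int[of b] by (auto intro: cong_scalar_left cong_scalar_right cong_sym)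
  then have "[a ^ p * b = a * b ^ p] (mod int p)"
    by (rule cong_trans)
  then have "(of_int (a ^ p * b) - of_int (a * b ^ p)) / of_nat p \<in> Zp"
    using Zp_cong_int[of "a ^ p * b" "a * b ^ p" 1] by simp
  then have "(of_int (a ^ p * b) - of_int (a * b ^ p)) / of_nat p * ((1 / of_int b) ^ (p + 1)) \<in> Zp"
    by (intro Zp_mult Zp_power Zp_inverse_of_int ab)
  also have "(of_int (a ^ p * b) - of_int (a * b ^ p)) / of_nat p * ((1 / of_int b) ^ (p + 1)) = (x ^ p - x) / of_nat p"
    using \<open>b \<noteq> 0\<close> p_pos unfolding ab(2) power_add power_one_right power_divide power_one
    by (simp add: field_simps)
  finally show ?thesis .
qed

end

text \<open>A prime factor of the reduced denominator divides the denominator in every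
  representation of x. This lets the rest of the argument fix one p.\<close>

lemma Ints_if_Zp_all:
  assumes "\<And>p. prime p \<Longrightarrow> x \<in> localization.Zp p"
  shows "x \<in> \<int>"
proof -
  obtain a b where ab: "quotient_of x = (a, b)" by force
  then have x: "x = of_int a / of_int b" and "b > 0" and cop: "coprime a b"
    by (auto simp: quotient_of_div quotient_of_denom_pos quotient_of_coprime)
  have "b = 1"
  proof (rule ccontr)
    assume "b \<noteq> 1"
    with \<open>b > 0\<close> have "nat b \<noteq> 1" by auto
    then obtain p where p: "prime p" "p dvd nat b"
      using prime_factor_nat by blast
    then have pb: "int p dvd b" using \<open>b > 0\<close> by (simp add: int_dvd_int_iff[symmetric] del: int_dvd_int_iff)
    interpret localization p using p by unfold_locales
    obtain c d :: int where cd: "\<not> int p dvd d" "x = of_int c / of_int d"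
      using assms[OF p(1)] unfolding Zp_def by blast
    then have "d \<noteq> 0" by auto
    have "(of_int (a * d) :: rat) = of_int (c * b)"
      using x cd(2) \<open>b > 0\<close> \<open>d \<noteq> 0\<close> by (simp add: field_simps)
    then have "a * d = c * b" by (simp only: of_int_eq_iff)
    then have "int p dvd a * d" using pb by simp
    then have "int p dvd a" using cd prime_int_p by (simp add: prime_dvd_mult_iff)
    with pb cop have "is_unit (int p)" by (meson coprime_common_divisor)
    then show False using prime_int_p not_prime_unit by blast
  qed
  with x show ?thesis by simp
qed

section \<open>Exponentials and Frobenius for power series\<close>

lemma fps_exp_of_nth_0 [simp]: "fps_exp_of f $ 0 = 1"
  by (simp add: fps_exp_of_def)

lemma fps_exp_of_0 [simp]: "fps_exp_of 0 = 1"
  by (simp add: fps_exp_of_def)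

lemma fps_deriv_exp_of:
  assumes "f $ 0 = 0"
  shows "fps_deriv (fps_exp_of f) = fps_exp_of f * fps_deriv f"
  unfolding fps_exp_of_def by (simp add: fps_compose_deriv[OF assms])

text \<open>The product of exp f, exp g and exp (-(f + g)) has derivative 0 and constant coefficient
  1, so it is 1.\<close>

lemma fps_exp_of_add:
  assumes "f $ 0 = 0" "g $ 0 = 0"
  shows "fps_exp_of (f + g) = fps_exp_of f * fps_exp_of g"
proof -
  have main: "fps_exp_of f * fps_exp_of g * fps_exp_of (- (f + g)) = 1"
    if "f $ 0 = 0" "g $ 0 = 0" for f g
  proof -
    have *: "(- (f + g)) $ 0 = 0" using that by simp
    have ring: "a * b * (c * - (x + y)) + (a * (b * y) + a * x * b) * c = 0" for a b c x y :: "rat fps"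
      by (simp add: algebra_simps)
    have "fps_deriv (fps_exp_of f * fps_exp_of g * fps_exp_of (- (f + g))) = 0"
      unfolding fps_deriv_mult fps_deriv_exp_of[OF *] fps_deriv_exp_of[OF that(1)]
        fps_deriv_exp_of[OF that(2)] fps_deriv_neg fps_deriv_add by (rule ring)
    then have "fps_exp_of f * fps_exp_of g * fps_exp_of (- (f + g)) =
        fps_const ((fps_exp_of f * fps_exp_of g * fps_exp_of (- (f + g))) $ 0)"
      by (simp only: fps_deriv_eq_0_iff)
    then show ?thesis by simp
  qed
  \<comment> \<open>Taking f + g and 0 in \<open>main\<close> shows that exp (-(f + g)) is the
    inverse of exp (f + g).\<close>
  have inv: "fps_exp_of (f + g) * fps_exp_of (- (f + g)) = 1"
    using main[of "f + g" 0] assms by simp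
  have "fps_exp_of (f + g) = fps_exp_of (f + g) * (fps_exp_of f * fps_exp_of g * fps_exp_of (- (f + g)))"
    unfolding main[OF assms] by simp
  also have "\<dots> = fps_exp_of f * fps_exp_of g * (fps_exp_of (f + g) * fps_exp_of (- (f + g)))"
    by (simp only: mult_ac)
  finally show ?thesis unfolding inv by simp
qed

lemma fps_exp_of_power:
  assumes "f $ 0 = 0"
  shows "fps_exp_of (of_nat n * f) = fps_exp_of f ^ n"
proof (induction n)
  case (Suc n)
  have "fps_exp_of (of_nat (Suc n) * f) = fps_exp_of (f + of_nat n * f)"
    by (simp add: distrib_right)
  also have "\<dots> = fps_exp_of f * fps_exp_of (of_nat n * f)"
    using assms by (intro fps_exp_of_add) simp_all
  finally show ?case using Suc by simp
qed simp

lemma fps_exp_of_compose: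
  assumes "f $ 0 = 0" "g $ 0 = 0"
  shows "fps_exp_of (f oo g) = fps_exp_of f oo g"
  unfolding fps_exp_of_def using assms by (simp add: fps_compose_assoc)

text \<open>\<open>fps_ln 1\<close> is the compositional inverse of exp - 1. This turns a rational
  power of an exponential into the exponential of a multiple, so that logarithms disappear.\<close>

lemma fps_log_of_exp_of:
  assumes "f $ 0 = 0"
  shows "fps_log_of (fps_exp_of f) = f"
proof -
  have "fps_exp_of f - 1 = (fps_exp 1 - 1) oo f"
    by (simp add: fps_exp_of_def fps_compose_sub_distrib)
  then have "fps_log_of (fps_exp_of f) = (fps_ln 1 oo (fps_exp 1 - 1)) oo f"
    unfolding fps_log_of_def using assms by (simp add: fps_compose_assoc)
  also have "fps_ln 1 oo (fps_exp (1 :: rat) - 1) = fps_X"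
    by (simp add: fps_ln_fps_exp_inv fps_inv)
  finally show ?thesis using assms by simp
qed

section \<open>Power series with p-integral coefficients and Frobenius\<close>

context localization
begin

definition Zp_fps :: "rat fps set" where
  "Zp_fps = {f. \<forall>n. f $ n \<in> Zp}"

lemma Zp_fpsI: "(\<And>n. f $ n \<in> Zp) \<Longrightarrow> f \<in> Zp_fps"
  by (simp add: Zp_fps_def)

lemma Zp_fpsD: "f \<in> Zp_fps \<Longrightarrow> f $ n \<in> Zp"
  by (simp add: Zp_fps_def)

lemma Zp_fps_const [intro]: "c \<in> Zp \<Longrightarrow> fps_const c \<in> Zp_fps"
  by (auto simp: Zp_fps_def)

lemma Zp_fps_X [intro, simp]: "fps_X \<in> Zp_fps"
  by (auto simp: Zp_fps_def fps_X_def)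

lemma Zp_fps_0 [intro, simp]: "0 \<in> Zp_fps"
  by (auto simp: Zp_fps_def)

lemma Zp_fps_1 [intro, simp]: "1 \<in> Zp_fps"
  by (auto simp: Zp_fps_def)

lemma Zp_fps_of_nat [intro, simp]: "of_nat n \<in> Zp_fps"
  unfolding fps_of_nat[symmetric] by auto

lemma Zp_fps_add [intro]: "f \<in> Zp_fps \<Longrightarrow> g \<in> Zp_fps \<Longrightarrow> f + g \<in> Zp_fps"
  by (auto simp: Zp_fps_def)

lemma Zp_fps_mult [intro]: "f \<in> Zp_fps \<Longrightarrow> g \<in> Zp_fps \<Longrightarrow> f * g \<in> Zp_fps"
  by (auto simp: Zp_fps_def fps_mult_nth)

lemma Zp_fps_power [intro]: "f \<in> Zp_fps \<Longrightarrow> f ^ n \<in> Zp_fps"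
  by (induction n) auto

lemma Zp_fps_sum [intro]: "(\<And>i. i \<in> I \<Longrightarrow> f i \<in> Zp_fps) \<Longrightarrow> sum f I \<in> Zp_fps"
  by (induction I rule: infinite_finite_induct) auto

lemma Zp_fps_inverse:
  assumes "f \<in> Zp_fps" "f $ 0 = 1"
  shows "inverse f \<in> Zp_fps"
proof (rule Zp_fpsI)
  fix n show "inverse f $ n \<in> Zp"
  proof (induction n rule: less_induct)
    case (less n)
    show ?case
    proof (cases "n = 0")
      case True
      then show ?thesis using assms(2) by simp
    next
      case False
      have "inverse f * f = 1"
        using assms(2) by (intro inverse_mult_eq_1) simp
      then have "(\<Sum>i=0..n. inverse f $ i * f $ (n - i)) = 0"
        using False by (metis fps_mult_nth fps_one_nth)
      moreover have "{0..n} = insert n {..<n}" by auto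
      ultimately have "inverse f $ n = - (\<Sum>i<n. inverse f $ i * f $ (n - i))"
        using assms(2) by (simp add: add_eq_0_iff2)
      also have "\<dots> \<in> Zp"
        using less.IH by (intro Zp_uminus Zp_sum Zp_mult Zp_fpsD[OF assms(1)]) auto
      finally show ?thesis .
    qed
  qed
qed

lemma power_p_add:
  assumes "f \<in> Zp_fps" "g \<in> Zp_fps"
  obtains W where "W \<in> Zp_fps" "(f + g) ^ p = f ^ p + g ^ p + of_nat p * W"
proof -
  define W where "W = (\<Sum>k\<in>{0<..<p}. of_nat ((p choose k) div p) * f ^ k * g ^ (p - k))"
  have "{..p} = insert 0 (insert p {0<..<p})" using p_pos by auto
  then have "(f + g) ^ p = f ^ p + g ^ p + (\<Sum>k\<in>{0<..<p}. of_nat (p choose k) * f ^ k * g ^ (p - k))"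
    using p_pos unfolding binomial_ring by simp
  also have "(\<Sum>k\<in>{0<..<p}. of_nat (p choose k) * f ^ k * g ^ (p - k)) = of_nat p * W"
    unfolding W_def sum_distrib_left
  proof (intro sum.cong refl)
    fix k assume "k \<in> {0<..<p}"
    then have "p dvd (p choose k)"
      using prime_p by (intro dvd_choose_prime) auto
    then have "of_nat (p choose k) = (of_nat p * of_nat ((p choose k) div p) :: rat fps)"
      by (metis dvd_mult_div_cancel of_nat_mult)
    then show "of_nat (p choose k) * f ^ k * g ^ (p - k) =
        of_nat p * (of_nat ((p choose k) div p) * f ^ k * g ^ (p - k))"
      by simp
  qed
  finally have "(f + g) ^ p = f ^ p + g ^ p + of_nat p * W" .
  moreover have "W \<in> Zp_fps"
    unfolding W_def by (intro Zp_fps_sum Zp_fps_mult Zp_fps_power Zp_fps_of_nat assms)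
  ultimately show ?thesis using that by simp
qed

text \<open>Polynomials suffice: the application is to a truncation whose coefficients are already
  known to be integral, while those of the full series are not.\<close>

lemma frobenius_fps:
  assumes "\<And>i. c i \<in> Zp"
  defines "t \<equiv> \<lambda>n. \<Sum>i<n. fps_const (c i) * fps_X ^ i"
  shows "\<exists>W\<in>Zp_fps. t n ^ p = (t n oo fps_X ^ p) + of_nat p * W"
proof (induction n)
  case 0
  show ?case using p_pos by (intro bexI[of _ 0]) (auto simp: t_def)
next
  case (Suc n)
  then obtain W where W: "W \<in> Zp_fps" "t n ^ p = (t n oo fps_X ^ p) + of_nat p * W" by blast
  have t: "t n \<in> Zp_fps" "fps_const (c n) * fps_X ^ n \<in> Zp_fps"
    unfolding t_def by (intro Zp_fps_sum Zp_fps_mult Zp_fps_const Zp_fps_power Zp_fps_X assms(1))+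
  obtain V where V: "V \<in> Zp_fps" "(t n + fps_const (c n) * fps_X ^ n) ^ p =
      t n ^ p + (fps_const (c n) * fps_X ^ n) ^ p + of_nat p * V"
    using power_p_add[OF t] by blast
  \<comment> \<open>The error of a single monomial is the Fermat quotient of its
    coefficient.\<close>
  define U where "U = fps_const ((c n ^ p - c n) / of_nat p) * fps_X ^ (n * p)"
  have U: "U \<in> Zp_fps" unfolding U_def by (intro Zp_fps_mult Zp_fps_const Zp_fps_power Zp_fps_X Zp_fermat assms(1))
  have X0: "(fps_X ^ p :: rat fps) $ 0 = 0" using p_pos by simp
  have "(fps_const (c n) * fps_X ^ n) oo fps_X ^ p = fps_const (c n) * fps_X ^ (n * p)"
    using X0 by (simp add: fps_compose_mult_distrib fps_compose_power[symmetric] power_mult[symmetric] mult.commute)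
  moreover have "(fps_const (c n) * fps_X ^ n) ^ p = fps_const (c n ^ p) * fps_X ^ (n * p)"
    by (simp add: power_mult_distrib power_mult fps_const_power)
  moreover have "fps_const (c n ^ p) * fps_X ^ (n * p) = fps_const (c n) * fps_X ^ (n * p) + of_nat p * U"
  proof -
    have "c n ^ p = c n + of_nat p * ((c n ^ p - c n) / of_nat p)" using p_pos by simp
    then have "fps_const (c n ^ p) = fps_const (c n) + of_nat p * fps_const ((c n ^ p - c n) / of_nat p)"
      by (metis fps_const_add fps_const_mult fps_of_nat)
    then show ?thesis unfolding U_def by (simp add: algebra_simps)
  qed
  ultimately have "t (Suc n) ^ p = (t (Suc n) oo fps_X ^ p) + of_nat p * (W + V + U)"
    using V(2) W(2) by (simp add: t_def fps_compose_add_distrib algebra_simps)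
  then show ?case using W(1) V(1) U by (intro bexI[of _ "W + V + U"] Zp_fps_add)
qed

end

section \<open>The Dieudonne--Dwork criterion\<close>

context localization
begin

text \<open>Up to sign this is Morita's p-adic gamma function at n + 1.\<close>

definition pfree_fact :: "nat \<Rightarrow> nat" where
  "pfree_fact n = (\<Prod>i=1..n. if p dvd i then 1 else i)"

lemma pfree_fact_0 [simp]: "pfree_fact 0 = 1"
  by (simp add: pfree_fact_def)

lemma pfree_fact_Suc: "pfree_fact (Suc n) = (if p dvd Suc n then 1 else Suc n) * pfree_fact n"
  by (simp add: pfree_fact_def mult.commute)

lemma not_dvd_pfree_fact: "\<not> p dvd pfree_fact n"
  using prime_p by (induction n) (auto simp: pfree_fact_Suc prime_dvd_mult_iff)

lemma pfree_fact_nonzero [simp]: "pfree_fact n \<noteq> 0"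
  using not_dvd_pfree_fact[of n] by (metis dvd_0_right)

text \<open>The multiples of p up to n are p times the numbers up to \<open>n div p\<close>.\<close>

lemma fact_decomp: "fact n = p ^ (n div p) * fact (n div p) * pfree_fact n"
proof (induction n)
  case (Suc n)
  show ?case
  proof (cases "p dvd Suc n")
    case True
    then have q: "Suc n div p = Suc (n div p)"
      by (simp add: div_Suc dvd_eq_mod_eq_0)
    with True have S: "Suc n = p * Suc (n div p)"
      by (metis dvd_mult_div_cancel)
    have "fact (Suc n) = Suc n * fact n"
      by (simp only: fact_Suc of_nat_id)
    also have "\<dots> = p * Suc (n div p) * fact n"
      by (subst S) (rule refl)
    also have "\<dots> = p * Suc (n div p) * (p ^ (n div p) * fact (n div p) * pfree_fact n)"
      by (subst Suc) (rule refl)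
    also have "\<dots> = p ^ Suc (n div p) * fact (Suc (n div p)) * pfree_fact n"
      by (simp only: fact_Suc of_nat_id power_Suc mult_ac)
    finally show ?thesis using True q by (simp add: pfree_fact_Suc)
  next
    case False
    then have q: "Suc n div p = n div p"
      by (simp add: div_Suc dvd_eq_mod_eq_0)
    have "fact (Suc n) = Suc n * fact n"
      by (simp only: fact_Suc of_nat_id)
    also have "\<dots> = Suc n * (p ^ (n div p) * fact (n div p) * pfree_fact n)"
      by (subst Suc) (rule refl)
    finally show ?thesis using False q by (simp add: pfree_fact_Suc algebra_simps)
  qed
qed simp

lemma fact_decomp_rat:
  "(fact n :: rat) = of_nat p ^ (n div p) * fact (n div p) * of_nat (pfree_fact n)"
proof -
  have "(fact n :: rat) = of_nat (p ^ (n div p) * fact (n div p) * pfree_fact n)"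
    by (metis fact_decomp of_nat_fact)
  then show ?thesis by simp
qed

text \<open>With k = i div p, i! is p^k k! up to a unit and 2k \<le> i: one factor p^k cancels and
  another feeds the induction. This covers p = 2 as well.\<close>

lemma power_p_div_fact: "i \<ge> 1 \<Longrightarrow> of_nat p ^ i / fact i / of_nat p \<in> Zp"
proof (induction i rule: less_induct)
  case (less i)
  define k where "k = i div p"
  have u: "1 / of_nat (pfree_fact i) \<in> Zp"
    by (intro Zp_inverse_of_nat not_dvd_pfree_fact)
  show ?case
  proof (cases "k = 0")
    case True
    have "of_nat p ^ i / fact i / of_nat p = (of_nat p ^ (i - 1) * (1 / of_nat (pfree_fact i)) :: rat)"
      using True less.prems p_pos by (subst fact_decomp_rat) (simp add: k_def power_eq_if)
    also have "\<dots> \<in> Zp" by (intro Zp_mult Zp_power Zp_of_nat u)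
    finally show ?thesis .
  next
    case False
    have "2 * k \<le> p * k" using p_ge_2 by simp
    also have "p * k \<le> i" by (simp add: k_def)
    finally have k: "2 * k \<le> i" .
    then have "of_nat p ^ i = (of_nat p ^ (i - 2 * k) * of_nat p ^ k * of_nat p ^ k :: rat)"
      by (simp add: power_add[symmetric])
    then have "of_nat p ^ i / fact i / of_nat p =
        (of_nat p ^ (i - 2 * k) * (of_nat p ^ k / fact k / of_nat p) * (1 / of_nat (pfree_fact i)) :: rat)"
      using p_pos by (subst fact_decomp_rat) (simp add: k_def)
    also have "\<dots> \<in> Zp"
      using less.IH[of k] k False by (intro Zp_mult Zp_power Zp_of_nat u) auto
    finally show ?thesis .
  qed
qed

lemma fps_exp_of_p_mult:
  assumes "h \<in> Zp_fps" "n \<ge> 1"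
  shows "fps_exp_of (of_nat p * h) $ n / of_nat p \<in> Zp"
proof -
  have "fps_exp_of (of_nat p * h) $ n / of_nat p
      = (\<Sum>i=0..n. (1 / fact i) * (of_nat p * h) ^ i $ n / of_nat p)"
    by (simp add: fps_exp_of_def fps_compose_nth sum_divide_distrib)
  also have "\<dots> \<in> Zp"
  proof (intro Zp_sum)
    fix i
    show "(1 / fact i) * (of_nat p * h) ^ i $ n / of_nat p \<in> Zp"
    proof (cases "i = 0")
      case True
      then show ?thesis using assms(2) by simp
    next
      case False
      have "of_nat p * h = fps_const (of_nat p) * h"
        by (simp add: fps_of_nat)
      then have "(of_nat p * h) ^ i = fps_const (of_nat p ^ i) * h ^ i"
        by (simp only: power_mult_distrib fps_const_power)
      then have "(1 / fact i) * (of_nat p * h) ^ i $ n / of_nat p =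
          of_nat p ^ i / fact i / of_nat p * (h ^ i $ n)"
        by simp
      also have "\<dots> \<in> Zp"
        using False by (intro Zp_mult power_p_div_fact Zp_fpsD Zp_fps_power assms) simp
      finally show ?thesis .
    qed
  qed
  finally show ?thesis .
qed

text \<open>
  With \<open>q = exp f\<close> the hypothesis says \<open>q(X)\<^sup>p = q(X\<^sup>p) (1 + p k(X))\<close> with \<open>k\<close> integral; by Frobenius,
  comparing coefficients of \<open>X\<^sup>n\<close> determines \<open>p q\<^sub>n\<close> modulo \<open>p\<close> from the earlier coefficients.
\<close>
theorem dieudonne_dwork:
  assumes f0: "f $ 0 = 0"
    and fp: "\<And>n. (of_nat p * f - (f oo fps_X ^ p)) $ n / of_nat p \<in> Zp"
  shows "fps_exp_of f \<in> Zp_fps"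
proof -
  define q where "q = fps_exp_of f"
  define h where "h = Abs_fps (\<lambda>n. (of_nat p * f - (f oo fps_X ^ p)) $ n / of_nat p)"
  define E where "E = fps_exp_of (of_nat p * h)"
  have q0: "q $ 0 = 1" by (simp add: q_def)
  have X0: "(fps_X ^ p :: rat fps) $ 0 = 0" using p_pos by simp
  have h: "h \<in> Zp_fps" using fp by (simp add: h_def Zp_fps_def)
  have h0: "h $ 0 = 0" using f0 by (simp add: h_def)
  have ph: "of_nat p * f = (f oo fps_X ^ p) + of_nat p * h"
    using p_pos by (simp add: fps_eq_iff h_def fps_of_nat[symmetric])
  have qp: "q ^ p = (q oo fps_X ^ p) * E"
  proof -
    have "q ^ p = fps_exp_of (of_nat p * f)"
      unfolding q_def by (rule fps_exp_of_power[OF f0, symmetric])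
    also have "\<dots> = fps_exp_of (f oo fps_X ^ p) * E"
      unfolding ph E_def by (rule fps_exp_of_add) (use f0 h0 in simp_all)
    finally show ?thesis
      unfolding q_def fps_exp_of_compose[OF f0 X0] .
  qed
  have "q $ n \<in> Zp" for n
  proof (induction n rule: less_induct)
    case (less n)
    show ?case
    proof (cases "n = 0")
      case True
      then show ?thesis using q0 by simp
    next
      case False
      \<comment> \<open>Cutting q off below degree n leaves a polynomial that is integral by
        induction; in \<open>q - t\<close> the first coefficient that can be nonzero is then
        q_n.\<close>
      define c where "c = (\<lambda>i. if i < n then q $ i else 0)"
      define t where "t = (\<Sum>i<n. fps_const (c i) * fps_X ^ i)"
      have tn: "t $ i = (if i < n then q $ i else 0)" for i
        unfolding t_def c_def fps_sum_nth by (simp add: if_distrib cong: if_cong)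
      have "c i \<in> Zp" for i using less.IH by (simp add: c_def)
      then obtain W where W: "W \<in> Zp_fps" "t ^ p = (t oo fps_X ^ p) + of_nat p * W"
        unfolding t_def using frobenius_fps[of c n] by blast
      \<comment> \<open>As \<open>q - t\<close> starts in degree n, only the constant coefficient of
        the cofactor S matters; it is p because q and t both start with 1.\<close>
      define S where "S = (\<Sum>i<p. t ^ (p - Suc i) * q ^ i)"
      have "q ^ p - t ^ p = (q - t) * S"
        unfolding S_def by (rule power_diff_sumr2)
      then have "(q ^ p) $ n = (t ^ p) $ n + ((q - t) * S) $ n"
        by (metis diff_add_cancel add.commute fps_add_nth)
      also have "((q - t) * S) $ n = (\<Sum>i=0..n. (q - t) $ i * S $ (n - i))"
        by (rule fps_mult_nth)
      also have "\<dots> = (\<Sum>i\<in>{n}. (q - t) $ i * S $ (n - i))"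
        by (rule sum.mono_neutral_right) (auto simp: tn)
      also have "\<dots> = q $ n * of_nat p"
        using q0 tn[of 0] tn[of n] False by (simp add: S_def fps_sum_nth fps_power_zeroth)
      finally have lhs: "(q ^ p) $ n = (t oo fps_X ^ p) $ n + of_nat p * W $ n + q $ n * of_nat p"
        using W(2) by (simp add: fps_of_nat[symmetric])
      \<comment> \<open>q(X^p) involves q only at indices i div p, which lie below n because n \<ge>
        1.\<close>
      have qX: "(q oo fps_X ^ p) $ i = (t oo fps_X ^ p) $ i" if "i \<le> n" for i
      proof -
        have "i div p < n" using that False p_ge_2
          by (metis div_eq_0_iff div_less_dividend gr0I le_trans less_le_trans linorder_not_le one_less_numeral_iff semiring_norm(76) zero_less_iff_neq_zero)
        then show ?thesis using p_pos by (simp add: fps_nth_compose_X_power tn)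
      qed
      have tX: "(t oo fps_X ^ p) $ i \<in> Zp" for i
        using less.IH p_pos by (simp add: fps_nth_compose_X_power tn)
      have "(q ^ p) $ n = (\<Sum>i=0..n. (q oo fps_X ^ p) $ i * E $ (n - i))"
        unfolding qp by (rule fps_mult_nth)
      also have "{0..n} = insert n {..<n}" by auto
      also have "(\<Sum>i\<in>insert n {..<n}. (q oo fps_X ^ p) $ i * E $ (n - i)) =
          (t oo fps_X ^ p) $ n + (\<Sum>i<n. (t oo fps_X ^ p) $ i * E $ (n - i))"
        using qX by (simp add: E_def)
      \<comment> \<open>The coefficients of t(X^p) in degree n cancel, and every remaining term
        carries a factor p.\<close>
      finally have "q $ n = (\<Sum>i<n. (t oo fps_X ^ p) $ i * (E $ (n - i) / of_nat p)) - W $ n"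
        using lhs p_pos by (simp add: field_simps sum_divide_distrib[symmetric])
      also have "\<dots> \<in> Zp"
        unfolding E_def by (intro Zp_diff Zp_sum Zp_mult tX fps_exp_of_p_mult h Zp_fpsD[OF W(1)]) auto
      finally show ?thesis .
    qed
  qed
  then show ?thesis by (simp add: q_def Zp_fps_def)
qed

end

section \<open>Formal congruences\<close>

context localization
begin

text \<open>The exponent \<open>Suc t\<close> against p^t is the surplus that pays for a division by
  p; the case t = 0 says that \<Phi> is constant modulo p.\<close>

definition adm :: "(nat \<Rightarrow> nat \<Rightarrow> rat) \<Rightarrow> bool" where
  "adm \<Phi> \<longleftrightarrow> (\<forall>x y. \<Phi> x y \<in> Zp) \<and>
     (\<forall>t x y m n. (\<Phi> (x + m * p ^ t) (y + n * p ^ t) - \<Phi> x y) / of_nat p ^ Suc t \<in> Zp)"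

lemma admI:
  assumes "\<And>x y. \<Phi> x y \<in> Zp"
    and "\<And>t x y m n. (\<Phi> (x + m * p ^ t) (y + n * p ^ t) - \<Phi> x y) / of_nat p ^ Suc t \<in> Zp"
  shows "adm \<Phi>"
  using assms unfolding adm_def by blast

lemma adm_Zp: "adm \<Phi> \<Longrightarrow> \<Phi> x y \<in> Zp"
  unfolding adm_def by blast

lemma adm_diff: "adm \<Phi> \<Longrightarrow> (\<Phi> (x + m * p ^ t) (y + n * p ^ t) - \<Phi> x y) / of_nat p ^ Suc t \<in> Zp"
  unfolding adm_def by blast

lemma adm_diff_0: "adm \<Phi> \<Longrightarrow> (\<Phi> x y - \<Phi> 0 0) / of_nat p \<in> Zp"
  using adm_diff[of \<Phi> 0 x 0 0 y] by simp

lemma Zp_diff_prod: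
  assumes "a \<in> Zp" "d \<in> Zp" "(a - b) / q \<in> Zp" "(c - d) / q \<in> Zp"
  shows "(a * c - b * d) / q \<in> Zp"
proof -
  have "(a * c - b * d) / q = a * ((c - d) / q) + (a - b) / q * d"
    by (cases "q = 0") (simp_all add: field_simps)
  also have "\<dots> \<in> Zp" using assms by (intro Zp_add Zp_mult)
  finally show ?thesis .
qed

lemma adm_mult:
  assumes "adm \<Phi>" "adm \<Psi>"
  shows "adm (\<lambda>x y. \<Phi> x y * \<Psi> x y)"
  by (rule admI; intro Zp_diff_prod Zp_mult adm_diff[OF assms(1)] adm_diff[OF assms(2)]
      adm_Zp[OF assms(1)] adm_Zp[OF assms(2)])

definition adm1 :: "(nat \<Rightarrow> rat) \<Rightarrow> bool" where
  "adm1 f \<longleftrightarrow> (\<forall>x. f x \<in> Zp) \<and> (\<forall>t x m. (f (x + m * p ^ t) - f x) / of_nat p ^ Suc t \<in> Zp)"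

lemma adm1_Zp: "adm1 f \<Longrightarrow> f x \<in> Zp"
  unfolding adm1_def by blast

lemma adm1_mult: "adm1 f \<Longrightarrow> adm1 g \<Longrightarrow> adm1 (\<lambda>x. f x * g x)"
  unfolding adm1_def by (auto intro!: Zp_diff_prod simp del: power_Suc)

lemma adm1_const: "c \<in> Zp \<Longrightarrow> adm1 (\<lambda>_. c)"
  unfolding adm1_def by auto

lemma adm1_prod: "(\<And>i. i \<in> I \<Longrightarrow> adm1 (f i)) \<Longrightarrow> adm1 (\<lambda>x. \<Prod>i\<in>I. f i x)"
  by (induction I rule: infinite_finite_induct) (auto intro!: adm1_mult adm1_const)

lemma adm_fst: "adm1 f \<Longrightarrow> adm (\<lambda>x y. f x)"
  unfolding adm_def adm1_def by blast

lemma adm_snd: "adm1 f \<Longrightarrow> adm (\<lambda>x y. f y)"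
  unfolding adm_def adm1_def by blast

text \<open>Substituting r + p x for x turns a shift by a multiple of p^t into one by a multiple of
  p^(t+1), which makes up for the power lost in dividing by p.\<close>

lemma adm_diff_quotient:
  assumes "adm \<Phi>"
  shows "adm (\<lambda>x y. (\<Phi> (r + p * x) (r' + p * y) - \<Phi> 0 0) / of_nat p)"
proof (rule admI)
  show "(\<Phi> (r + p * x) (r' + p * y) - \<Phi> 0 0) / of_nat p \<in> Zp" for x y
    using assms by (rule adm_diff_0)
  fix t x y m n
  have quot: "((a - c) / of_nat p - (b - c) / of_nat p) / of_nat p ^ Suc t = (a - b) / of_nat p ^ Suc (Suc t)"
    for a b c :: rat
    by (simp add: diff_divide_distrib)
  have arg: "r + p * (x + m * p ^ t) = (r + p * x) + m * p ^ Suc t" for r x m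
    by (simp add: distrib_left)
  show "((\<Phi> (r + p * (x + m * p ^ t)) (r' + p * (y + n * p ^ t)) - \<Phi> 0 0) / of_nat p -
         (\<Phi> (r + p * x) (r' + p * y) - \<Phi> 0 0) / of_nat p) / of_nat p ^ Suc t \<in> Zp"
    unfolding quot arg using assms by (rule adm_diff)
qed

end

section \<open>Antisymmetric sums over base-p blocks\<close>

definition block_pairs :: "nat \<Rightarrow> nat \<Rightarrow> nat \<Rightarrow> nat \<Rightarrow> (nat \<times> nat) set" where
  "block_pairs p s m K = {(i, k). i + k = K \<and> i div p ^ s = m}"

lemma finite_block_pairs [simp, intro]: "finite (block_pairs p s m K)"
  by (rule finite_subset[of _ "{..K} \<times> {..K}"]) (auto simp: block_pairs_def)

text \<open>Only i is confined to a block, so exchanging i and k does not make the sum vanish; the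
  skew kernel serves to kill constant \<Phi>.\<close>

definition skew_sum :: "nat \<Rightarrow> (nat \<Rightarrow> rat) \<Rightarrow> nat \<Rightarrow> nat \<Rightarrow> nat \<Rightarrow> (nat \<Rightarrow> nat \<Rightarrow> rat) \<Rightarrow> rat" where
  "skew_sum p A s m K \<Phi> = (\<Sum>(i, k)\<in>block_pairs p s m K. A i * A k * (\<Phi> i k - \<Phi> k i))"

locale dwork = localization +
  fixes A :: "nat \<Rightarrow> rat" and R :: "nat \<Rightarrow> nat \<Rightarrow> rat"
  assumes A_Zp: "A n \<in> Zp"
    and A_nonzero: "A n \<noteq> 0"
    and A_step: "v < p \<Longrightarrow> A (v + p * u) = A u * R v u"
    and R_adm: "v < p \<Longrightarrow> adm1 (R v)"
begin

abbreviation T :: "nat \<Rightarrow> nat \<Rightarrow> nat \<Rightarrow> (nat \<Rightarrow> nat \<Rightarrow> rat) \<Rightarrow> rat" where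
  "T \<equiv> skew_sum p A"

lemma T_linear: "T s m K (\<lambda>x y. a * \<Phi> x y + b * \<Psi> x y) = a * T s m K \<Phi> + b * T s m K \<Psi>"
  unfolding skew_sum_def sum_distrib_left sum.distrib[symmetric]
  by (intro sum.cong refl) (auto simp: algebra_simps)

lemma T_const: "T s m K (\<lambda>x y. c) = 0"
  by (simp add: skew_sum_def)

definition lifted :: "nat \<Rightarrow> nat \<Rightarrow> (nat \<Rightarrow> nat \<Rightarrow> rat) \<Rightarrow> nat \<Rightarrow> nat \<Rightarrow> rat" where
  "lifted r r' \<Phi> x y = R r x * R r' y * \<Phi> (r + p * x) (r' + p * y)"

text \<open>The possible last digits of i and k when i + k = K. The bound r + r' \<le> K keeps the
  truncated subtraction exact.\<close>

definition carry :: "nat \<Rightarrow> (nat \<times> nat) set" where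
  "carry K = {(r, r') \<in> {..<p} \<times> {..<p}. r + r' \<le> K \<and> p dvd K - (r + r')}"

lemma finite_carry [simp, intro]: "finite (carry K)"
  by (rule finite_subset[of _ "{..<p} \<times> {..<p}"]) (auto simp: carry_def)

lemma sum_block_pairs_Suc:
  "(\<Sum>(i, k)\<in>block_pairs p (Suc s) m K. g i k) =
   (\<Sum>(r, r')\<in>carry K. \<Sum>(i, k)\<in>block_pairs p s m ((K - (r + r')) div p). g (r + p * i) (r' + p * k))"
proof -
  let ?S = "Sigma (carry K) (\<lambda>(r, r'). block_pairs p s m ((K - (r + r')) div p))"
  have "(\<Sum>(i, k)\<in>block_pairs p (Suc s) m K. g i k) =
      (\<Sum>((r, r'), (i, k))\<in>?S. g (r + p * i) (r' + p * k))"
  proof (rule sum.reindex_bij_witness[of _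
      "\<lambda>((r, r'), (i, k)). (r + p * i, r' + p * k)"
      "\<lambda>(i, k). ((i mod p, k mod p), (i div p, k div p))"], goal_cases)
    case (1 a)
    show ?case by (simp add: case_prod_unfold)
  next
    case (2 a)
    then obtain i k where a: "a = (i, k)" "i + k = K" "i div p ^ Suc s = m"
      by (auto simp: block_pairs_def)
    have "i = i mod p + p * (i div p)" "k = k mod p + p * (k div p)"
      by simp_all
    then have "K = (i mod p + k mod p) + p * (i div p + k div p)"
      unfolding distrib_left using a(2) by linarith
    then have "i mod p + k mod p \<le> K" "K - (i mod p + k mod p) = p * (i div p + k div p)"
      by linarith+
    then have "(i mod p, k mod p) \<in> carry K" "(K - (i mod p + k mod p)) div p = i div p + k div p"
      using p_pos by (simp_all add: carry_def)
    moreover have "i div p div p ^ s = m"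
      using a(3) by (simp add: div_mult2_eq)
    ultimately show ?case
      using a(1) by (simp add: block_pairs_def)
  next
    case (3 b)
    then show ?case using p_pos by (auto simp: carry_def)
  next
    case (4 b)
    then obtain r r' i k where b: "b = ((r, r'), (i, k))" "r < p" "r' < p" "r + r' \<le> K"
        "p dvd K - (r + r')" "i + k = (K - (r + r')) div p" "i div p ^ s = m"
      by (auto simp: carry_def block_pairs_def)
    have "p * (i + k) = K - (r + r')" using b(5,6) by simp
    then have "(r + p * i) + (r' + p * k) = K" using b(4) by (simp add: algebra_simps)
    moreover have "(r + p * i) div p ^ Suc s = m"
      using b(2,7) by (simp add: div_mult2_eq)
    ultimately show ?case using b(1) by (auto simp: block_pairs_def)
  next
    case (5 a)
    show ?case by (simp add: case_prod_unfold)
  qed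
  then show ?thesis
    by (simp add: sum.Sigma case_prod_unfold)
qed

lemma T_Suc:
  "T (Suc s) m K \<Phi> = (\<Sum>(r, r')\<in>carry K. T s m ((K - (r + r')) div p) (lifted r r' \<Phi>))"
proof -
  let ?B = "\<lambda>r r'. block_pairs p s m ((K - (r + r')) div p)"
  let ?g = "\<lambda>\<Phi> i k. A i * A k * \<Phi> i k"
  have split: "T s m K \<Phi> = (\<Sum>(i, k)\<in>block_pairs p s m K. ?g \<Phi> i k) -
      (\<Sum>(i, k)\<in>block_pairs p s m K. ?g (\<lambda>x y. \<Phi> y x) i k)" for s K \<Phi>
    unfolding skew_sum_def sum_subtractf[symmetric]
    by (intro sum.cong refl) (auto simp: algebra_simps)
  have 1: "(\<Sum>(i, k)\<in>block_pairs p (Suc s) m K. ?g \<Phi> i k) =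
      (\<Sum>(r, r')\<in>carry K. \<Sum>(i, k)\<in>?B r r'. ?g (lifted r r' \<Phi>) i k)"
    unfolding sum_block_pairs_Suc
    by (intro sum.cong refl) (auto simp: carry_def A_step lifted_def intro!: sum.cong)
  have "(\<Sum>(i, k)\<in>block_pairs p (Suc s) m K. ?g (\<lambda>x y. \<Phi> y x) i k) =
      (\<Sum>(r, r')\<in>carry K. \<Sum>(i, k)\<in>?B r r'. ?g (\<lambda>x y. lifted r' r \<Phi> y x) i k)"
    unfolding sum_block_pairs_Suc
    by (intro sum.cong refl) (auto simp: carry_def A_step lifted_def intro!: sum.cong)
  \<comment> \<open>\<open>carry K\<close> and the inner blocks are symmetric in r and r', so
    exchanging the digits makes this half the mirror image of the other, and the inner sums are
    again of the form T.\<close>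
  also have "\<dots> = (\<Sum>(r, r')\<in>carry K. \<Sum>(i, k)\<in>?B r r'. ?g (\<lambda>x y. lifted r r' \<Phi> y x) i k)"
    by (rule sum.reindex_bij_witness[of _ prod.swap prod.swap]) (auto simp: carry_def add.commute)
  finally have 2: "(\<Sum>(i, k)\<in>block_pairs p (Suc s) m K. ?g (\<lambda>x y. \<Phi> y x) i k) =
      (\<Sum>(r, r')\<in>carry K. \<Sum>(i, k)\<in>?B r r'. ?g (\<lambda>x y. lifted r r' \<Phi> y x) i k)" .
  show ?thesis
    unfolding split[of "Suc s"] 1 2 sum_subtractf[symmetric]
    by (intro sum.cong refl) (auto simp: split)
qed

text \<open>
  A form of Dwork's formal congruences. Only the part of \<open>\<Phi>\<close> that is constant on all of \<open>\<nat>\<close> obstructs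
  gaining a factor \<open>p\<close> in \<open>T_Suc\<close>, and its contribution vanishes by antisymmetry.
\<close>
theorem dwork_congruence:
  assumes "adm \<Phi>"
  shows "T s m K \<Phi> / (of_nat p ^ Suc s * A m) \<in> Zp"
  using assms
proof (induction s arbitrary: K \<Phi>)
  case 0
  \<comment> \<open>A block of length 1 contains only i = m, so \<open>A i\<close> cancels A(m);
    subtracting \<open>\<Phi> 0 0\<close> twice changes nothing and exposes the factor p.\<close>
  have "T 0 m K \<Phi> / (of_nat p ^ Suc 0 * A m) =
      (\<Sum>(i, k)\<in>block_pairs p 0 m K. A k * ((\<Phi> i k - \<Phi> 0 0) / of_nat p - (\<Phi> k i - \<Phi> 0 0) / of_nat p))"
    unfolding skew_sum_def sum_divide_distrib
    by (intro sum.cong refl)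
      (auto simp: block_pairs_def A_nonzero p_pos diff_divide_distrib[symmetric])
  also have "\<dots> \<in> Zp"
    by (auto intro!: Zp_sum Zp_mult Zp_diff A_Zp adm_diff_0[OF 0])
  finally show ?case .
next
  case (Suc s)
  define \<chi> where "\<chi> = (\<lambda>r r' x y. (\<Phi> (r + p * x) (r' + p * y) - \<Phi> 0 0) / of_nat p)"
  have alg: "a * b * c = d * (a * b * 1) + of_nat p * (a * b * ((c - d) / of_nat p))" for a b c d :: rat
    using p_pos by (simp add: field_simps)
  have lift: "lifted r r' \<Phi> = (\<lambda>x y. \<Phi> 0 0 * lifted r r' (\<lambda>_ _. 1) x y +
      of_nat p * (R r x * R r' y * \<chi> r r' x y))" for r r'
    unfolding lifted_def \<chi>_def by (intro ext) (rule alg)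
  \<comment> \<open>For a single pair of digits the constant part need not vanish, as its kernel
    carries R. Summed over all digits it folds back by \<open>T_Suc\<close> into T of a
    constant.\<close>
  have "T (Suc s) m K \<Phi> = \<Phi> 0 0 * T (Suc s) m K (\<lambda>_ _. 1) +
      of_nat p * (\<Sum>(r, r')\<in>carry K. T s m ((K - (r + r')) div p) (\<lambda>x y. R r x * R r' y * \<chi> r r' x y))"
    unfolding T_Suc lift T_linear sum_distrib_left sum.distrib[symmetric]
    by (intro sum.cong refl) auto
  then have "T (Suc s) m K \<Phi> / (of_nat p ^ Suc (Suc s) * A m) =
      (\<Sum>(r, r')\<in>carry K. T s m ((K - (r + r')) div p) (\<lambda>x y. R r x * R r' y * \<chi> r r' x y)
        / (of_nat p ^ Suc s * A m))"
    using p_pos by (simp add: T_const sum_divide_distrib case_prod_unfold mult.assoc)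
  also have "\<dots> \<in> Zp"
  proof (intro Zp_sum, clarify)
    fix r r' assume "(r, r') \<in> carry K"
    then have "r < p" "r' < p" by (auto simp: carry_def)
    then have "adm (\<lambda>x y. R r x * R r' y * \<chi> r r' x y)"
      unfolding \<chi>_def
      by (intro adm_mult adm_diff_quotient Suc.prems adm_fst[OF R_adm] adm_snd[OF R_adm])
    then show "T s m ((K - (r + r')) div p) (\<lambda>x y. R r x * R r' y * \<chi> r r' x y)
        / (of_nat p ^ Suc s * A m) \<in> Zp"
      by (rule Suc.IH)
  qed
  finally show ?case .
qed

end

section \<open>Factorial ratios and harmonic numbers\<close>

definition fact_ratio1 :: "nat \<Rightarrow> nat \<Rightarrow> rat" where
  "fact_ratio1 N m = fact (N * m) / fact m ^ N"

lemma fact_ratio_eq_prod: "fact_ratio k N m = (\<Prod>j=1..k. fact_ratio1 (N j) m)"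
  by (simp add: fact_ratio_def fact_ratio1_def)

text \<open>For m \<ge> 1 this counts the partitions of N m objects into N unlabelled classes of
  size m, so it equals (N m)! / (m!^N N!). The product form makes divisibility evident when N grows.
  At m = 0 it is 1, without the factor 1 / N!.\<close>

definition reduced_ratio1 :: "nat \<Rightarrow> nat \<Rightarrow> nat" where
  "reduced_ratio1 N m = (\<Prod>n=1..N. (n * m - 1) choose (m - 1))"

lemma fact_ratio1_eq:
  assumes "m \<ge> 1"
  shows "fact_ratio1 N m = fact N * of_nat (reduced_ratio1 N m)"
proof (induction N)
  case 0
  show ?case by (simp add: fact_ratio1_def reduced_ratio1_def)
next
  case (Suc N)
  let ?b = "(Suc N * m - 1) choose (m - 1)"
  have "m * ((Suc N * m) choose m) = Suc N * m * ?b"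
    using assms by (intro times_binomial_minus1_eq) simp
  then have "m * ((Suc N * m) choose m) = m * (Suc N * ?b)"
    by (simp only: mult_ac)
  then have b: "(Suc N * m) choose m = Suc N * ?b"
    using assms by (subst (asm) mult_cancel1) simp
  have "(of_nat ((Suc N * m) choose m) :: rat) = fact (Suc N * m) / (fact m * fact (N * m))"
    by (subst binomial_fact) simp_all
  then have "fact_ratio1 (Suc N) m = fact_ratio1 N m * of_nat ((Suc N * m) choose m)"
    by (simp add: fact_ratio1_def)
  also have "\<dots> = fact N * of_nat (reduced_ratio1 N m) * of_nat (Suc N * ?b)"
    by (simp only: b Suc)
  also have "\<dots> = fact (Suc N) * of_nat (reduced_ratio1 (Suc N) m)"
    by (simp add: reduced_ratio1_def del: mult_Suc)
  finally show ?case .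
qed

lemma fact_ratio_eq:
  assumes "m \<ge> 1"
  shows "fact_ratio k N m = of_nat (M_const k N) * of_nat (\<Prod>j=1..k. reduced_ratio1 (N j) m)"
  using assms by (simp add: fact_ratio_eq_prod fact_ratio1_eq M_const_def prod.distrib)

lemma reduced_ratio1_mono_dvd: "N \<le> N' \<Longrightarrow> reduced_ratio1 N m dvd reduced_ratio1 N' m"
  unfolding reduced_ratio1_def by (rule prod_dvd_prod_subset) auto

lemma fact_ratio1_nonzero [simp]: "fact_ratio1 N m \<noteq> 0"
  by (simp add: fact_ratio1_def)

lemma fact_ratio1_0 [simp]: "fact_ratio1 N 0 = 1"
  by (simp add: fact_ratio1_def)

lemma fact_add: "(fact (n + c) :: rat) = fact n * (\<Prod>i=1..c. of_nat (n + i))"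
  by (induction c) (simp_all add: algebra_simps)

lemma harmonic_rat_0 [simp]: "harmonic_rat 0 = 0"
  by (simp add: harmonic_rat_def)

lemma harmonic_rat_Suc: "harmonic_rat (Suc n) = harmonic_rat n + 1 / of_nat (Suc n)"
  by (simp add: harmonic_rat_def)

lemma harmonic_rat_add: "harmonic_rat (n + b) = harmonic_rat n + (\<Sum>i=1..b. 1 / of_nat (n + i))"
  by (induction b) (simp_all add: harmonic_rat_Suc)

text \<open>The first multiple w of d beyond L works: L! divides (w - 1)!, so d L! divides w!. When
  d \<le> L, the bound a \<ge> 2 gives w \<le> L + d \<le> L a.\<close>

lemma dvd_fact_mult:
  assumes "d \<ge> 1" "d \<le> L * a" "a \<ge> 2"
  shows "d * fact L dvd (fact (L * a) :: nat)"
proof -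
  define w where "w = d * (L div d + 1)"
  have "L < w"
    using dividend_less_times_div[of d L] assms(1) by (simp add: w_def algebra_simps)
  have "2 * L \<le> L * a" using assms(3) by simp
  have "w \<le> L * a"
  proof (cases "d \<le> L")
    case True
    have "w \<le> L + d" by (simp add: w_def)
    then show ?thesis using True \<open>2 * L \<le> L * a\<close> by linarith
  next
    case False
    then show ?thesis using assms(2) by (simp add: w_def)
  qed
  have "d * fact L dvd w * fact (w - 1)"
    using \<open>L < w\<close> by (intro mult_dvd_mono fact_dvd) (auto simp: w_def)
  also have "w * fact (w - 1) = fact w"
    using \<open>L < w\<close> by (simp add: fact_reduce)
  also have "(fact w :: nat) dvd fact (L * a)"
    using \<open>w \<le> L * a\<close> by (rule fact_dvd)
  finally show ?thesis .
qed

section \<open>Factorial ratios and harmonic numbers modulo powers of p\<close>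

context localization
begin

lemma Zp_cong_nat: "[a = b] (mod p ^ t) \<Longrightarrow> (of_nat a - of_nat b) / of_nat p ^ t \<in> Zp"
  using Zp_cong_int[of "int a" "int b" t] cong_int_iff[of a b "p ^ t"] by simp

lemma pfree_fact_add:
  assumes "p dvd q"
  shows "[pfree_fact (x + q) = pfree_fact x * pfree_fact q] (mod q)"
proof (induction x)
  case (Suc x)
  have "[(if p dvd Suc (x + q) then 1 else Suc (x + q)) = (if p dvd Suc x then 1 else Suc x)] (mod q)"
  proof -
    have "p dvd Suc (x + q) \<longleftrightarrow> p dvd Suc x"
      using assms by (metis add_Suc dvd_add_left_iff)
    moreover have "[Suc (x + q) = Suc x] (mod q)"
      by (metis add_Suc cong_add_rcancel_0_nat cong_def mod_add_self2)
    ultimately show ?thesis by simp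
  qed
  from cong_mult[OF this Suc] show ?case
    by (simp only: pfree_fact_Suc add_Suc mult.assoc)
qed simp

lemma pfree_fact_add_mult:
  assumes "p dvd q"
  shows "[pfree_fact (x + k * q) = pfree_fact x * pfree_fact q ^ k] (mod q)"
proof (induction k)
  case (Suc k)
  have "[pfree_fact ((x + k * q) + q) = pfree_fact (x + k * q) * pfree_fact q] (mod q)"
    using assms by (rule pfree_fact_add)
  also have "[pfree_fact (x + k * q) * pfree_fact q = pfree_fact x * pfree_fact q ^ k * pfree_fact q] (mod q)"
    using Suc by (rule cong_mult) simp
  finally show ?case by (simp add: algebra_simps)
qed simp

text \<open>For v < p this is A(v + pu) / A(u) with a single N. The first factor collects the
  multiples of p beyond p N u and up to N (v + pu), the second the numbers prime to p.\<close>

definition step_ratio1 :: "nat \<Rightarrow> nat \<Rightarrow> nat \<Rightarrow> rat" where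
  "step_ratio1 N v u =
     (of_nat p ^ (N * v div p) * (\<Prod>i=1..N * v div p. of_nat (N * u + i))) *
     (of_nat (pfree_fact (N * (v + p * u))) / of_nat (pfree_fact (v + p * u)) ^ N)"

lemma fact_ratio1_step:
  assumes "v < p"
  shows "fact_ratio1 N (v + p * u) = fact_ratio1 N u * step_ratio1 N v u"
proof -
  have d1: "(v + p * u) div p = u" using assms by simp
  have "N * (v + p * u) = N * v + p * (N * u)" by (simp add: algebra_simps)
  then have d2: "N * (v + p * u) div p = N * u + N * v div p"
    using p_pos by simp
  have f1: "(fact (v + p * u) :: rat) = of_nat p ^ u * fact u * of_nat (pfree_fact (v + p * u))"
    by (subst fact_decomp_rat) (simp only: d1)
  have f2: "(fact (N * (v + p * u)) :: rat) = of_nat p ^ (N * u + N * v div p) *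
      (fact (N * u) * (\<Prod>i=1..N * v div p. of_nat (N * u + i))) * of_nat (pfree_fact (N * (v + p * u)))"
    by (subst fact_decomp_rat) (simp only: d2 fact_add)
  have pw: "(of_nat p :: rat) ^ (N * u + N * v div p) = (of_nat p ^ u) ^ N * of_nat p ^ (N * v div p)"
    by (simp add: power_add power_mult[symmetric] mult.commute)
  show ?thesis
    unfolding fact_ratio1_def step_ratio1_def f1 f2 pw power_mult_distrib
    using p_pos by (simp add: field_simps)
qed

text \<open>With q = p^(t+1), shifting x by m p^t shifts y by m q and multiplies numerator and
  denominator by the same \<open>w ^ (N * m)\<close> modulo q. It cancels, so w is never
  evaluated.\<close>

lemma adm1_pfree_quotient:
  "adm1 (\<lambda>u. of_nat (pfree_fact (N * (v + p * u))) / of_nat (pfree_fact (v + p * u)) ^ N)"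
  unfolding adm1_def
proof (intro conjI allI)
  have inv: "1 / of_nat (pfree_fact n) \<in> Zp" for n
    by (intro Zp_inverse_of_nat not_dvd_pfree_fact)
  fix x
  have "of_nat (pfree_fact (N * (v + p * x))) / of_nat (pfree_fact (v + p * x)) ^ N =
      (of_nat (pfree_fact (N * (v + p * x))) * (1 / of_nat (pfree_fact (v + p * x))) ^ N :: rat)"
    by (simp add: power_divide)
  also have "\<dots> \<in> Zp" by (intro Zp_mult Zp_power inv Zp_of_nat)
  finally show "of_nat (pfree_fact (N * (v + p * x))) / of_nat (pfree_fact (v + p * x)) ^ N \<in> Zp" .
  fix t m
  define y where "y = v + p * x"
  define q where "q = p ^ Suc t"
  define w where "w = pfree_fact q"
  have q: "p dvd q" by (simp add: q_def)
  have y': "v + p * (x + m * p ^ t) = y + m * q"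
    by (simp add: y_def q_def algebra_simps)
  have "[pfree_fact (y + m * q) ^ N = (pfree_fact y * w ^ m) ^ N] (mod q)"
    unfolding w_def by (intro cong_pow pfree_fact_add_mult q)
  then have "[pfree_fact (N * y) * pfree_fact (y + m * q) ^ N =
      pfree_fact (N * y) * (pfree_fact y * w ^ m) ^ N] (mod q)"
    by (intro cong_mult cong_refl)
  also have "pfree_fact (N * y) * (pfree_fact y * w ^ m) ^ N =
      pfree_fact (N * y) * w ^ (N * m) * pfree_fact y ^ N"
    by (simp add: power_mult_distrib power_mult[symmetric] mult.commute)
  finally have 1: "[pfree_fact (N * y) * pfree_fact (y + m * q) ^ N =
      pfree_fact (N * y) * w ^ (N * m) * pfree_fact y ^ N] (mod q)" .
  have "[pfree_fact (N * y + (N * m) * q) = pfree_fact (N * y) * w ^ (N * m)] (mod q)"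
    unfolding w_def using q by (rule pfree_fact_add_mult)
  then have "[pfree_fact (N * (y + m * q)) * pfree_fact y ^ N =
      pfree_fact (N * y) * w ^ (N * m) * pfree_fact y ^ N] (mod q)"
    by (intro cong_mult cong_refl) (simp add: algebra_simps)
  with 1 have "[pfree_fact (N * (y + m * q)) * pfree_fact y ^ N =
      pfree_fact (N * y) * pfree_fact (y + m * q) ^ N] (mod p ^ Suc t)"
    unfolding q_def by (meson cong_sym cong_trans)
  then have "(of_nat (pfree_fact (N * (y + m * q)) * pfree_fact y ^ N) -
      of_nat (pfree_fact (N * y) * pfree_fact (y + m * q) ^ N)) / of_nat p ^ Suc t \<in> Zp"
    by (rule Zp_cong_nat)
  then have "(of_nat (pfree_fact (N * (y + m * q)) * pfree_fact y ^ N) -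
      of_nat (pfree_fact (N * y) * pfree_fact (y + m * q) ^ N)) / of_nat p ^ Suc t *
      ((1 / of_nat (pfree_fact (y + m * q))) ^ N * (1 / of_nat (pfree_fact y)) ^ N) \<in> Zp"
    by (intro Zp_mult Zp_power inv)
  also have "(of_nat (pfree_fact (N * (y + m * q)) * pfree_fact y ^ N) -
      of_nat (pfree_fact (N * y) * pfree_fact (y + m * q) ^ N)) / of_nat p ^ Suc t *
      ((1 / of_nat (pfree_fact (y + m * q))) ^ N * (1 / of_nat (pfree_fact y)) ^ N) =
      (of_nat (pfree_fact (N * (y + m * q))) / of_nat (pfree_fact (y + m * q)) ^ N -
       of_nat (pfree_fact (N * y)) / of_nat (pfree_fact y) ^ N) / (of_nat p ^ Suc t :: rat)"
  proof -
    have "(a * d ^ N - c * b ^ N) / e * ((1 / b) ^ N * (1 / d) ^ N) = (a / b ^ N - c / d ^ N) / e"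
      if "b \<noteq> 0" "d \<noteq> 0" "e \<noteq> 0" for a b c d e :: rat
      using that by (simp add: power_divide field_simps)
    then show ?thesis
      unfolding of_nat_mult of_nat_power by this (use p_pos in simp_all)
  qed
  finally show "(of_nat (pfree_fact (N * (v + p * (x + m * p ^ t)))) / of_nat (pfree_fact (v + p * (x + m * p ^ t))) ^ N -
       of_nat (pfree_fact (N * (v + p * x))) / of_nat (pfree_fact (v + p * x)) ^ N) / of_nat p ^ Suc t \<in> Zp"
    unfolding y' y_def[symmetric] .
qed

text \<open>The product alone merely respects congruences; the surplus p comes from p^c if c \<ge>
  1, and for c = 0 the function is constant.\<close>

lemma adm1_rising:
  "adm1 (\<lambda>u. of_nat p ^ c * (\<Prod>i=1..c. of_nat (N * u + i)))"
proof (cases c)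
  case 0
  then show ?thesis by (simp add: adm1_const)
next
  case (Suc c')
  show ?thesis
    unfolding adm1_def
  proof (intro conjI allI)
    show "of_nat p ^ c * (\<Prod>i=1..c. of_nat (N * x + i)) \<in> Zp" for x
      by (intro Zp_mult Zp_power Zp_prod Zp_of_nat)
    fix t x m
    let ?a = "\<Prod>i=1..c. N * (x + m * p ^ t) + i" and ?b = "\<Prod>i=1..c. N * x + i"
    have "[?a = ?b] (mod p ^ t)"
    proof (rule cong_prod)
      fix i
      have shift: "N * (x + m * p ^ t) + i = (N * x + i) + (N * m) * p ^ t"
        by (simp add: algebra_simps)
      show "[N * (x + m * p ^ t) + i = N * x + i] (mod p ^ t)"
        unfolding shift by (simp only: cong_def mod_mult_self1)
    qed
    then have "of_nat p ^ c' * ((of_nat ?a - of_nat ?b) / of_nat p ^ t) \<in> Zp"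
      by (intro Zp_mult Zp_power Zp_of_nat Zp_cong_nat)
    also have "of_nat p ^ c' * ((of_nat ?a - of_nat ?b) / of_nat p ^ t) =
        (of_nat p ^ c * of_nat ?a - of_nat p ^ c * of_nat ?b) / (of_nat p ^ Suc t :: rat)"
      using p_pos by (simp add: Suc field_simps del: of_nat_prod)
    finally show "(of_nat p ^ c * (\<Prod>i=1..c. of_nat (N * (x + m * p ^ t) + i)) -
        of_nat p ^ c * (\<Prod>i=1..c. of_nat (N * x + i))) / of_nat p ^ Suc t \<in> Zp"
      by (simp only: of_nat_prod)
  qed
qed

lemma adm1_step_ratio1: "adm1 (step_ratio1 N v)"
  using adm1_mult[OF adm1_rising adm1_pfree_quotient] by (simp only: step_ratio1_def[abs_def])

lemma fact_ratio1_Zp: "fact_ratio1 N m \<in> Zp"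
proof (cases "m = 0")
  case False
  then have "fact_ratio1 N m = of_nat (fact N * reduced_ratio1 N m)"
    by (simp add: fact_ratio1_eq)
  then show ?thesis by (simp only: Zp_of_nat)
qed simp

lemma dwork_fact_ratio:
  "dwork p (fact_ratio k N) (\<lambda>v u. \<Prod>j=1..k. step_ratio1 (N j) v u)"
proof unfold_locales
  show "fact_ratio k N n \<in> Zp" for n
    unfolding fact_ratio_eq_prod by (intro Zp_prod fact_ratio1_Zp)
  show "fact_ratio k N n \<noteq> 0" for n
    by (simp add: fact_ratio_eq_prod)
  show "fact_ratio k N (v + p * u) = fact_ratio k N u * (\<Prod>j=1..k. step_ratio1 (N j) v u)" if "v < p" for v u
    using that by (simp add: fact_ratio_eq_prod fact_ratio1_step prod.distrib)
  show "adm1 (\<lambda>u. \<Prod>j=1..k. step_ratio1 (N j) v u)" for v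
    by (intro adm1_prod adm1_step_ratio1)
qed

text \<open>In p H_n the terms with index divisible by p add up to H_{n div p}; the others are p
  times a p-integral number.\<close>

lemma harmonic_div: "(of_nat p * harmonic_rat n - harmonic_rat (n div p)) / of_nat p \<in> Zp"
proof (induction n)
  case (Suc n)
  show ?case
  proof (cases "p dvd Suc n")
    case True
    then have q: "Suc n div p = Suc (n div p)"
      by (simp add: div_Suc dvd_eq_mod_eq_0)
    with True have "Suc n = p * Suc (n div p)"
      by (metis dvd_mult_div_cancel)
    then have "(of_nat (Suc n) :: rat) = of_nat p * of_nat (Suc (n div p))"
      by (metis of_nat_mult)
    then have "of_nat p * harmonic_rat (Suc n) - harmonic_rat (Suc n div p) =
        of_nat p * harmonic_rat n - harmonic_rat (n div p)"
      using p_pos unfolding q harmonic_rat_Suc by (simp add: distrib_left del: of_nat_Suc)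
    then show ?thesis using Suc by simp
  next
    case False
    then have q: "Suc n div p = n div p"
      by (simp add: div_Suc dvd_eq_mod_eq_0)
    have "(of_nat p * harmonic_rat (Suc n) - harmonic_rat (Suc n div p)) / of_nat p =
        (of_nat p * harmonic_rat n - harmonic_rat (n div p)) / of_nat p + 1 / of_nat (Suc n)"
      using p_pos unfolding q harmonic_rat_Suc
      by (simp add: diff_divide_distrib add_divide_distrib distrib_left del: of_nat_Suc)
    also have "\<dots> \<in> Zp"
      using Suc False by (intro Zp_add Zp_inverse_of_nat)
    finally show ?thesis .
  qed
qed simp

lemma harmonic_mult_power:
  "(of_nat p ^ s * harmonic_rat (n * p ^ s) - harmonic_rat n) / of_nat p \<in> Zp"
proof (induction s)
  case (Suc s)
  have "n * p ^ Suc s div p = n * p ^ s"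
    using p_pos by simp
  then have "(of_nat p * harmonic_rat (n * p ^ Suc s) - harmonic_rat (n * p ^ s)) / of_nat p \<in> Zp"
    using harmonic_div[of "n * p ^ Suc s"] by simp
  then have "of_nat p ^ s * ((of_nat p * harmonic_rat (n * p ^ Suc s) - harmonic_rat (n * p ^ s)) / of_nat p) +
      (of_nat p ^ s * harmonic_rat (n * p ^ s) - harmonic_rat n) / of_nat p \<in> Zp"
    by (intro Zp_add Zp_mult Zp_power Zp_of_nat Suc)
  also have "of_nat p ^ s * ((of_nat p * harmonic_rat (n * p ^ Suc s) - harmonic_rat (n * p ^ s)) / of_nat p) +
      (of_nat p ^ s * harmonic_rat (n * p ^ s) - harmonic_rat n) / of_nat p =
      (of_nat p ^ Suc s * harmonic_rat (n * p ^ Suc s) - harmonic_rat n) / of_nat p"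
    using p_pos by (simp add: field_simps)
  finally show ?case .
qed simp

lemma step_ratio1_divide:
  assumes "1 \<le> i" "i \<le> N * v div p"
  shows "step_ratio1 N v u / (of_nat p * of_nat (N * u + i)) \<in> Zp"
proof -
  let ?c = "N * v div p"
  let ?P = "\<Prod>l\<in>{1..?c} - {i}. (of_nat (N * u + l) :: rat)"
  let ?g = "(of_nat (pfree_fact (N * (v + p * u))) / of_nat (pfree_fact (v + p * u)) ^ N :: rat)"
  have "(\<Prod>l=1..?c. (of_nat (N * u + l) :: rat)) = of_nat (N * u + i) * ?P"
    using assms by (intro prod.remove) auto
  moreover have "(of_nat p :: rat) ^ ?c = of_nat p * of_nat p ^ (?c - 1)"
    using assms by (simp add: power_eq_if)
  moreover have "a * b * (c * d) * e / (a * c) = b * d * e" if "a \<noteq> 0" "c \<noteq> 0" for a b c d e :: rat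
    using that by simp
  ultimately have "step_ratio1 N v u / (of_nat p * of_nat (N * u + i)) = of_nat p ^ (?c - 1) * ?P * ?g"
    unfolding step_ratio1_def using assms(1) p_pos by (simp del: of_nat_add)
  also have "\<dots> \<in> Zp"
    by (intro Zp_mult Zp_power Zp_prod Zp_of_nat adm1_Zp[OF adm1_pfree_quotient])
  finally show ?thesis .
qed

text \<open>For x \<ge> p the divisor sits in the step from x div p to x. For x < p that step starts
  at 0, where no factor L! is available, so p i and L! are found together in (L x)!; this is where x
  \<ge> 2 enters.\<close>

lemma reduced_ratio1_divide:
  assumes x: "x \<ge> 2" and i: "1 \<le> i" "i \<le> L * (x mod p) div p"
  shows "of_nat (reduced_ratio1 L x) / (of_nat p * of_nat (L * (x div p) + i)) \<in> Zp"
proof (cases "x < p")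
  case False
  define j where "j = x div p"
  have j: "j \<ge> 1" using False p_pos by (simp add: j_def div_greater_zero_iff Suc_le_eq)
  have "fact_ratio1 L (x mod p + p * j) = fact_ratio1 L j * step_ratio1 L (x mod p) j"
    using p_pos by (intro fact_ratio1_step) simp
  then have "fact_ratio1 L x = fact_ratio1 L j * step_ratio1 L (x mod p) j"
    by (simp add: j_def)
  then have "of_nat (reduced_ratio1 L x) = of_nat (reduced_ratio1 L j) * step_ratio1 L (x mod p) j"
    using j x by (simp add: fact_ratio1_eq)
  then have "of_nat (reduced_ratio1 L x) / (of_nat p * of_nat (L * j + i)) =
      of_nat (reduced_ratio1 L j) * (step_ratio1 L (x mod p) j / (of_nat p * of_nat (L * j + i)))"
    by simp
  also have "\<dots> \<in> Zp"
    by (intro Zp_mult Zp_of_nat step_ratio1_divide i)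
  finally show ?thesis by (simp only: j_def)
next
  case True
  have "p * i \<le> p * (L * x div p)" using i(2) True by simp
  also have "\<dots> \<le> L * x" by simp
  finally have pi: "p * i \<le> L * x" .
  have nd: "\<not> p dvd fact x"
    using True by (simp add: prime_dvd_fact_iff[OF prime_p])
  have "fact L * of_nat (reduced_ratio1 L x) = (fact (L * x) / fact x ^ L :: rat)"
    using x by (simp add: fact_ratio1_eq[symmetric] fact_ratio1_def)
  then have "(of_nat (reduced_ratio1 L x) / (of_nat p * of_nat i) :: rat) =
      of_nat (fact (L * x)) / of_nat (p * i * fact L) * (1 / of_nat (fact x)) ^ L"
    using i(1) p_pos by (simp add: power_divide field_simps)
  also have "\<dots> \<in> Zp"
    using i(1) p_pos
    by (intro Zp_mult Zp_power Zp_inverse_of_nat nd Zp_divide_dvd dvd_fact_mult pi x) simp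
  finally show ?thesis using True by simp
qed

text \<open>Modulo p, p H_{Lx} agrees with H at (L x) div p = L j + b, where b is a carry; the b
  extra terms 1 / (L j + i) are what the reduced ratio has to absorb.\<close>

lemma reduced_ratio1_harmonic:
  assumes \<Theta>: "\<theta> \<in> Zp" "\<theta> * harmonic_rat L \<in> Zp" and x: "x \<ge> 1"
  shows "of_nat (reduced_ratio1 L x) * \<theta> *
    ((of_nat p * harmonic_rat (L * x) - harmonic_rat (L * (x div p))) / of_nat p) \<in> Zp"
proof -
  define a j where "a = x mod p" and "j = x div p"
  define b where "b = L * a div p"
  let ?c = "of_nat (reduced_ratio1 L x) :: rat"
  have "L * x = L * a + p * (L * j)"
    unfolding a_def j_def by (metis distrib_left mod_mult_div_eq mult.left_commute)
  then have div: "L * x div p = L * j + b"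
    using p_pos by (simp add: b_def)
  have "?c * \<theta> * ((harmonic_rat (L * j + b) - harmonic_rat (L * j)) / of_nat p) \<in> Zp"
  proof (cases "x = 1")
    case True
    \<comment> \<open>The reduced ratio is 1 and absorbs nothing. The extra terms form H_{L div p},
      which is p H_L up to a multiple of p, and \<theta> H_L is integral.\<close>
    then have "j = 0" "b = L div p" "?c = 1"
      using p_ge_2 by (simp_all add: j_def a_def b_def reduced_ratio1_def)
    then have "?c * \<theta> * ((harmonic_rat (L * j + b) - harmonic_rat (L * j)) / of_nat p) =
        \<theta> * harmonic_rat L - \<theta> * ((of_nat p * harmonic_rat L - harmonic_rat (L div p)) / of_nat p)"
      using p_pos by (simp add: field_simps)
    also have "\<dots> \<in> Zp" by (intro Zp_diff Zp_mult \<Theta> harmonic_div)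
    finally show ?thesis .
  next
    case False
    have "?c * \<theta> * ((harmonic_rat (L * j + b) - harmonic_rat (L * j)) / of_nat p) =
        \<theta> * (\<Sum>i=1..b. ?c / (of_nat p * of_nat (L * j + i)))"
      by (simp add: harmonic_rat_add sum_distrib_left sum_divide_distrib mult_ac del: of_nat_add of_nat_mult)
    also have "\<dots> \<in> Zp"
      unfolding j_def using False x
      by (intro Zp_mult Zp_sum \<Theta> reduced_ratio1_divide) (auto simp: b_def a_def)
    finally show ?thesis .
  qed
  moreover have "?c * \<theta> * ((of_nat p * harmonic_rat (L * x) - harmonic_rat (L * j + b)) / of_nat p) \<in> Zp"
    unfolding div[symmetric] by (intro Zp_mult Zp_of_nat \<Theta> harmonic_div)
  ultimately have "?c * \<theta> * ((of_nat p * harmonic_rat (L * x) - harmonic_rat (L * j + b)) / of_nat p) +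
      ?c * \<theta> * ((harmonic_rat (L * j + b) - harmonic_rat (L * j)) / of_nat p) \<in> Zp"
    by (intro Zp_add)
  also have "?c * \<theta> * ((of_nat p * harmonic_rat (L * x) - harmonic_rat (L * j + b)) / of_nat p) +
      ?c * \<theta> * ((harmonic_rat (L * j + b) - harmonic_rat (L * j)) / of_nat p) =
      ?c * \<theta> * ((of_nat p * harmonic_rat (L * x) - harmonic_rat (L * j)) / of_nat p)"
    unfolding distrib_left[symmetric] add_divide_distrib[symmetric] by simp
  finally show ?thesis by (simp only: j_def)
qed

lemma fact_ratio_harmonic:
  assumes \<Theta>: "\<theta> \<in> Zp" "\<theta> * harmonic_rat L \<in> Zp"
    and j: "j \<in> {1..k}" "L \<le> N j"
  shows "fact_ratio k N x * \<theta> / of_nat (M_const k N) *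
    ((of_nat p * harmonic_rat (L * x) - harmonic_rat (L * (x div p))) / of_nat p) \<in> Zp"
proof (cases "x = 0")
  case False
  have "reduced_ratio1 L x dvd reduced_ratio1 (N j) x"
    using j(2) by (rule reduced_ratio1_mono_dvd)
  also have "\<dots> dvd (\<Prod>j=1..k. reduced_ratio1 (N j) x)"
    using j(1) by (intro dvd_prodI) auto
  finally obtain e where e: "(\<Prod>j=1..k. reduced_ratio1 (N j) x) = reduced_ratio1 L x * e"
    by (elim dvdE)
  have "fact_ratio k N x = of_nat (M_const k N) * of_nat (\<Prod>j=1..k. reduced_ratio1 (N j) x)"
    using False by (simp add: fact_ratio_eq)
  moreover have "M_const k N \<noteq> 0" by (simp add: M_const_def)
  ultimately have "fact_ratio k N x * \<theta> / of_nat (M_const k N) = of_nat e * (of_nat (reduced_ratio1 L x) * \<theta>)"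
    unfolding e by simp
  then have "fact_ratio k N x * \<theta> / of_nat (M_const k N) *
      ((of_nat p * harmonic_rat (L * x) - harmonic_rat (L * (x div p))) / of_nat p) =
      of_nat e * (of_nat (reduced_ratio1 L x) * \<theta> *
        ((of_nat p * harmonic_rat (L * x) - harmonic_rat (L * (x div p))) / of_nat p))"
    by (simp only: mult.assoc)
  also have "\<dots> \<in> Zp"
    using False by (intro Zp_mult[OF Zp_of_nat reduced_ratio1_harmonic] \<Theta>) simp
  finally show ?thesis .
qed simp

end

section \<open>Coefficients of the Dieudonne--Dwork difference\<close>

lemma F_series_nth_0 [simp]: "F_series k N $ 0 = 1"
  by (simp add: F_series_def fact_ratio_eq_prod)

lemma G_series_nth_0 [simp]: "G_series L k N $ 0 = 0"
  by (simp add: G_series_def)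

lemma G_div_F: "G_series L k N / F_series k N = G_series L k N * inverse (F_series k N)"
  by (simp add: fps_divide_unit)

lemma fps_mult_compose_X_power_nth:
  fixes f g :: "'a :: comm_ring_1 fps"
  assumes "a < p"
  shows "(f * (g oo fps_X ^ p)) $ (a + p * K) = (\<Sum>j\<le>K. f $ (a + p * j) * g $ (K - j))"
proof -
  let ?n = "a + p * K"
  have p: "p > 0" using assms by simp
  have "(f * (g oo fps_X ^ p)) $ ?n =
      (\<Sum>i=0..?n. f $ i * (if p dvd ?n - i then g $ ((?n - i) div p) else 0))"
    using p by (simp add: fps_mult_nth fps_nth_compose_X_power)
  also have "\<dots> = (\<Sum>i\<in>(\<lambda>j. a + p * j) ` {..K}.
      f $ i * (if p dvd ?n - i then g $ ((?n - i) div p) else 0))"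
  proof (rule sum.mono_neutral_right)
    show "\<forall>i\<in>{0..?n} - (\<lambda>j. a + p * j) ` {..K}.
        f $ i * (if p dvd ?n - i then g $ ((?n - i) div p) else 0) = 0"
    proof
      fix i assume i: "i \<in> {0..?n} - (\<lambda>j. a + p * j) ` {..K}"
      have "\<not> p dvd ?n - i"
      proof
        assume "p dvd ?n - i"
        then obtain l where l: "?n - i = p * l" by (elim dvdE)
        have "l \<le> K"
        proof (rule ccontr)
          assume "\<not> l \<le> K"
          then have "p * (K + 1) \<le> p * l" by (intro mult_le_mono2) simp
          then show False using l assms by simp
        qed
        then have "p * (K - l) + p * l = p * K"
          by (simp add: distrib_left[symmetric])
        then have "i = a + p * (K - l)" using l i by auto
        then show False using i by auto
      qed
      then show "f $ i * (if p dvd ?n - i then g $ ((?n - i) div p) else 0) = 0" by simp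
    qed
  qed auto
  also have "\<dots> = (\<Sum>j\<le>K. f $ (a + p * j) *
      (if p dvd ?n - (a + p * j) then g $ ((?n - (a + p * j)) div p) else 0))"
    using p by (subst sum.reindex) (auto simp: inj_on_def)
  also have "\<dots> = (\<Sum>j\<le>K. f $ (a + p * j) * g $ (K - j))"
    using p by (intro sum.cong refl) (simp add: diff_mult_distrib2[symmetric])
  finally show ?thesis .
qed

lemma skew_sum_eq:
  "skew_sum p A s m K \<Phi> =
    (\<Sum>j\<in>{j \<in> {..K}. j div p ^ s = m}. A j * A (K - j) * (\<Phi> j (K - j) - \<Phi> (K - j) j))"
  unfolding skew_sum_def
  by (rule sum.reindex_bij_witness[of _ "\<lambda>j. (j, K - j)" fst]) (auto simp: block_pairs_def)

context localization
begin

text \<open>\<open>j div p ^ s * p ^ s\<close> is j with its last s digits cleared, so the sum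
  clears one digit after another; K steps suffice because K < p^K. Writing both arguments through
  \<open>j div p ^ s\<close> makes each term depend on the block only.\<close>

lemma telescope_blocks:
  fixes h :: "nat \<Rightarrow> rat"
  assumes "h 0 = 0" "j \<le> K"
  shows "h j = (\<Sum>s<K. h (j div p ^ s * p ^ s) - h (j div p ^ s div p * p ^ Suc s))"
proof -
  have "K < p ^ K"
    using less_exp[of K] power_mono[of 2 p K] p_ge_2 by linarith
  have "(\<Sum>s<K. h (j div p ^ s * p ^ s) - h (j div p ^ s div p * p ^ Suc s)) =
      (\<Sum>s<K. h (j div p ^ s * p ^ s) - h (j div p ^ Suc s * p ^ Suc s))"
    by (simp add: div_mult2_eq[symmetric] mult.commute)
  also have "\<dots> = h (j div p ^ 0 * p ^ 0) - h (j div p ^ K * p ^ K)"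
    by (rule sum_lessThan_telescope')
  also have "j div p ^ K = 0"
    using \<open>K < p ^ K\<close> assms(2) by simp
  finally show ?thesis using assms(1) by simp
qed

lemma fact_ratio_div_M_Zp:
  assumes "x \<ge> 1"
  shows "fact_ratio k N x / of_nat (M_const k N) \<in> Zp"
proof -
  have "fact_ratio k N x = of_nat (M_const k N) * of_nat (\<Prod>j=1..k. reduced_ratio1 (N j) x)"
    using assms by (rule fact_ratio_eq)
  moreover have "M_const k N \<noteq> 0" by (simp add: M_const_def)
  ultimately have "fact_ratio k N x / of_nat (M_const k N) = of_nat (\<Prod>j=1..k. reduced_ratio1 (N j) x)"
    by simp
  then show ?thesis by (simp only: Zp_of_nat)
qed

text \<open>Multiplied by p^s, the two harmonic numbers become H_{Lm} and H_{L (m div p)} / p up to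
  integral errors, which leaves \<open>fact_ratio_harmonic\<close> at x = m.\<close>

lemma fact_ratio_block_harmonic:
  assumes \<Theta>: "\<theta> \<in> Zp" "\<theta> * harmonic_rat L \<in> Zp"
    and j: "j \<in> {1..k}" "L \<le> N j"
  shows "fact_ratio k N m * \<theta> / of_nat (M_const k N) *
    (of_nat p ^ s * (harmonic_rat (L * (m * p ^ s)) - harmonic_rat (L * (m div p * p ^ Suc s)))) \<in> Zp"
proof (cases "m = 0")
  case False
  let ?c = "fact_ratio k N m * \<theta> / of_nat (M_const k N)"
  define \<eta> where "\<eta> = (\<lambda>n s. (of_nat p ^ s * harmonic_rat (n * p ^ s) - harmonic_rat n) / of_nat p)"
  have \<eta>: "\<eta> n s \<in> Zp" for n s
    unfolding \<eta>_def by (rule harmonic_mult_power)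
  have "?c = fact_ratio k N m / of_nat (M_const k N) * \<theta>" by simp
  also have "\<dots> \<in> Zp"
    using False by (intro Zp_mult fact_ratio_div_M_Zp \<Theta>) simp
  finally have c: "?c \<in> Zp" .
  have 1: "of_nat p ^ s * harmonic_rat (L * (m * p ^ s)) = harmonic_rat (L * m) + of_nat p * \<eta> (L * m) s"
    using p_pos by (simp add: \<eta>_def mult.assoc)
  have "of_nat p ^ Suc s * harmonic_rat (L * (m div p * p ^ Suc s)) =
      harmonic_rat (L * (m div p)) + of_nat p * \<eta> (L * (m div p)) (Suc s)"
    using p_pos by (simp add: \<eta>_def mult.assoc)
  then have 2: "of_nat p ^ s * harmonic_rat (L * (m div p * p ^ Suc s)) =
      harmonic_rat (L * (m div p)) / of_nat p + \<eta> (L * (m div p)) (Suc s)"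
    using p_pos by (simp add: field_simps)
  have "?c * (of_nat p ^ s * (harmonic_rat (L * (m * p ^ s)) - harmonic_rat (L * (m div p * p ^ Suc s)))) =
      ?c * ((of_nat p * harmonic_rat (L * m) - harmonic_rat (L * (m div p))) / of_nat p) +
      ?c * (of_nat p * \<eta> (L * m) s - \<eta> (L * (m div p)) (Suc s))"
    unfolding right_diff_distrib[of "of_nat p ^ s"] 1 2 distrib_left[symmetric]
    using p_pos by (simp add: diff_divide_distrib)
  also have "\<dots> \<in> Zp"
    by (intro Zp_add fact_ratio_harmonic[where N = N, OF \<Theta> j] Zp_mult[OF c] Zp_diff Zp_mult[OF Zp_of_nat] \<eta>)
  finally show ?thesis .
qed simp

lemma dwork_coefficient:
  assumes \<Theta>: "\<theta> \<in> Zp" "\<theta> * harmonic_rat L \<in> Zp"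
    and j: "j \<in> {1..k}" "L \<le> N j" and a: "a < p"
  defines "A \<equiv> fact_ratio k N" and "h \<equiv> \<lambda>n. harmonic_rat (L * n)"
  shows "\<theta> / of_nat (M_const k N) / of_nat p *
    (\<Sum>j\<le>K. A (a + p * j) * A (K - j) * (of_nat p * h (a + p * j) - h (K - j))) \<in> Zp"
proof -
  define R where "R = (\<lambda>v u. \<Prod>j=1..k. step_ratio1 (N j) v u)"
  interpret dwork p A R
    unfolding A_def R_def by (rule dwork_fact_ratio)
  define c where "c = \<theta> / of_nat (M_const k N)"
  define \<tau> where "\<tau> = (\<lambda>j. A j * A (K - j) * (R a j - R a (K - j)))"
  define \<Delta> where "\<Delta> = (\<lambda>s m. h (m * p ^ s) - h (m div p * p ^ Suc s))"
  have h0: "h 0 = 0" by (simp add: h_def)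
  have reflect: "(\<Sum>j\<le>K. A j * A (K - j) * (R a j * h (K - j))) =
      (\<Sum>j\<le>K. A j * A (K - j) * (R a (K - j) * h j))"
    by (rule sum.reindex_bij_witness[of _ "\<lambda>j. K - j" "\<lambda>j. K - j"]) auto
  have "(\<Sum>j\<le>K. A j * A (K - j) * (R a j * (h j - h (K - j)))) =
      (\<Sum>j\<le>K. A j * A (K - j) * (R a j * h j)) - (\<Sum>j\<le>K. A j * A (K - j) * (R a j * h (K - j)))"
    unfolding sum_subtractf[symmetric] by (intro sum.cong refl) (simp add: algebra_simps)
  also have "\<dots> = (\<Sum>j\<le>K. h j * \<tau> j)"
    unfolding reflect sum_subtractf[symmetric] \<tau>_def by (intro sum.cong refl) (simp add: algebra_simps)
  also have "\<dots> = (\<Sum>j\<le>K. (\<Sum>s<K. \<Delta> s (j div p ^ s)) * \<tau> j)"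
    unfolding \<Delta>_def
    by (intro sum.cong refl arg_cong2[where f = "(*)"] telescope_blocks[where h = h, OF h0]) simp
  also have "\<dots> = (\<Sum>s<K. \<Sum>j\<le>K. \<Delta> s (j div p ^ s) * \<tau> j)"
    unfolding sum_distrib_right by (rule sum.swap)
  \<comment> \<open>Grouping j by its block m pulls \<Delta> out; the inner sum is T with kernel
    \<open>R a x\<close>.\<close>
  also have "\<dots> = (\<Sum>s<K. \<Sum>m\<le>K. \<Delta> s m * T s m K (\<lambda>x y. R a x))"
  proof (rule sum.cong[OF refl])
    fix s
    have "(\<Sum>j\<le>K. \<Delta> s (j div p ^ s) * \<tau> j) =
        (\<Sum>m\<le>K. \<Sum>j\<in>{j \<in> {..K}. j div p ^ s = m}. \<Delta> s (j div p ^ s) * \<tau> j)"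
      by (rule sum.group[symmetric]) (auto intro: order.trans[OF div_le_dividend])
    then show "(\<Sum>j\<le>K. \<Delta> s (j div p ^ s) * \<tau> j) = (\<Sum>m\<le>K. \<Delta> s m * T s m K (\<lambda>x y. R a x))"
      unfolding skew_sum_eq sum_distrib_left by (simp add: \<tau>_def)
  qed
  finally have blocks: "(\<Sum>j\<le>K. A j * A (K - j) * (R a j * (h j - h (K - j)))) =
      (\<Sum>s<K. \<Sum>m\<le>K. \<Delta> s m * T s m K (\<lambda>x y. R a x))" .

  \<comment> \<open>c A(m) p^s makes \<Delta> integral, the congruence supplies p^(s+1) A(m), and
    the spare p pays for the division by p.\<close>
  have main: "c / of_nat p * (\<Delta> s m * T s m K (\<lambda>x y. R a x)) \<in> Zp" for s m
  proof -
    have "A m * c * (of_nat p ^ s * \<Delta> s m) \<in> Zp"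
      using fact_ratio_block_harmonic[where N = N and m = m and s = s, OF \<Theta> j] by (simp add: A_def c_def \<Delta>_def h_def)
    then have "A m * c * (of_nat p ^ s * \<Delta> s m) * (T s m K (\<lambda>x y. R a x) / (of_nat p ^ Suc s * A m)) \<in> Zp"
      by (rule Zp_mult) (intro dwork_congruence adm_fst R_adm a)
    then show ?thesis
      using p_pos A_nonzero[of m] by (simp add: field_simps)
  qed

  have near: "c / of_nat p * (A (a + p * i) * A (K - i) * (of_nat p * h (a + p * i) - h i)) \<in> Zp" for i
  proof -
    have "(a + p * i) div p = i" using a by simp
    then have "A (a + p * i) * c * ((of_nat p * h (a + p * i) - h i) / of_nat p) * A (K - i) \<in> Zp"
      using fact_ratio_harmonic[where N = N and x = "a + p * i", OF \<Theta> j]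
      by (intro Zp_mult[OF _ A_Zp]) (simp add: A_def c_def h_def)
    then show ?thesis by (simp add: mult_ac)
  qed

  \<comment> \<open>Only the second sum factors A(a + pj) as A(j) R(a, j); in the first it stays
    whole, because \<open>near\<close> needs it to absorb M.\<close>
  have "(\<Sum>j\<le>K. A (a + p * j) * A (K - j) * (of_nat p * h (a + p * j) - h (K - j))) =
      (\<Sum>j\<le>K. A (a + p * j) * A (K - j) * (of_nat p * h (a + p * j) - h j)) +
      (\<Sum>j\<le>K. A j * A (K - j) * (R a j * (h j - h (K - j))))"
    unfolding sum.distrib[symmetric] by (intro sum.cong refl) (simp only: A_step[OF a], simp add: algebra_simps)
  then have "c / of_nat p *
      (\<Sum>j\<le>K. A (a + p * j) * A (K - j) * (of_nat p * h (a + p * j) - h (K - j))) =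
      (\<Sum>j\<le>K. c / of_nat p * (A (a + p * j) * A (K - j) * (of_nat p * h (a + p * j) - h j))) +
      (\<Sum>s<K. \<Sum>m\<le>K. c / of_nat p * (\<Delta> s m * T s m K (\<lambda>x y. R a x)))"
    by (simp only: blocks distrib_left sum_distrib_left)
  also have "\<dots> \<in> Zp"
    by (intro Zp_add Zp_sum near main)
  finally show ?thesis by (simp only: c_def)
qed

theorem exp_G_div_F_Zp:
  assumes \<Theta>: "\<theta> \<in> Zp" "\<theta> * harmonic_rat L \<in> Zp"
    and j: "j \<in> {1..k}" "L \<le> N j"
  shows "fps_exp_of (fps_const (\<theta> / of_nat (M_const k N)) * (G_series L k N / F_series k N)) \<in> Zp_fps"
proof -
  define c where "c = \<theta> / of_nat (M_const k N)"
  define F where "F = F_series k N"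
  define G where "G = G_series L k N"
  define F' where "F' = F oo fps_X ^ p"
  define G' where "G' = G oo fps_X ^ p"
  \<comment> \<open>This is p f(X) - f(X^p) cleared of its denominator F(X) F(X^p) and divided by p;
    clearing is harmless as F is integral with constant coefficient 1.\<close>
  define W where "W = fps_const (c / of_nat p) * (of_nat p * G * F' - F * G')"
  define f where "f = fps_const c * (G / F)"
  have X0: "(fps_X ^ p :: rat fps) $ 0 = 0" using p_pos by simp
  have F0: "F $ 0 = 1" "F' $ 0 = 1" by (simp_all add: F_def F'_def)
  have f: "f = fps_const c * G * inverse F"
    by (simp add: f_def F_def G_def G_div_F mult.assoc)
  have F: "F \<in> Zp_fps"
  proof (rule Zp_fpsI)
    show "F $ n \<in> Zp" for n
      unfolding F_def F_series_def by (simp add: dwork.A_Zp[OF dwork_fact_ratio])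
  qed
  have F': "F' \<in> Zp_fps"
    using F p_pos by (auto simp: Zp_fps_def F'_def fps_nth_compose_X_power)
  have W: "W \<in> Zp_fps"
  proof (rule Zp_fpsI)
    fix n
    define a K where "a = n mod p" and "K = n div p"
    have n: "n = a + p * K" and a: "a < p" using p_pos by (simp_all add: a_def K_def)
    have "W $ n = c / of_nat p * (of_nat p * (G * F') $ n - (F * G') $ n)"
      by (simp add: W_def mult.assoc fps_of_nat[symmetric])
    also have "of_nat p * (G * F') $ n - (F * G') $ n =
        (\<Sum>j\<le>K. of_nat p * (G $ (a + p * j) * F $ (K - j)) - F $ (a + p * j) * G $ (K - j))"
      unfolding F'_def G'_def n fps_mult_compose_X_power_nth[OF a] sum_distrib_left sum_subtractf ..
    also have "\<dots> = (\<Sum>j\<le>K. fact_ratio k N (a + p * j) * fact_ratio k N (K - j) *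
        (of_nat p * harmonic_rat (L * (a + p * j)) - harmonic_rat (L * (K - j))))"
      by (intro sum.cong refl) (simp add: F_def G_def F_series_def G_series_def algebra_simps)
    finally show "W $ n \<in> Zp"
      using dwork_coefficient[where N = N and K = K, OF \<Theta> j a] by (simp only: c_def)
  qed
  have "of_nat p * f - (f oo fps_X ^ p) = of_nat p * (W * inverse F * inverse F')"
  proof -
    have invX: "inverse F oo fps_X ^ p = inverse F'"
      unfolding F'_def using F0(1) p_pos by (intro fps_inverse_compose) simp_all
    have fX: "f oo fps_X ^ p = fps_const c * G' * inverse F'"
      unfolding f G'_def fps_compose_mult_distrib[OF X0] invX by simp
    have inv: "F * inverse F = 1" "F' * inverse F' = 1"
      using F0 by (simp_all add: inverse_mult_eq_1')
    have c: "of_nat p * fps_const (c / of_nat p) = fps_const c"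
      using p_pos by (simp add: fps_of_nat[symmetric])
    have "of_nat p * (W * inverse F * inverse F') =
        (of_nat p * fps_const (c / of_nat p)) *
        (of_nat p * G * inverse F * (F' * inverse F') - G' * inverse F' * (F * inverse F))"
      unfolding W_def by (simp add: algebra_simps)
    also have "\<dots> = of_nat p * f - (f oo fps_X ^ p)"
      unfolding inv c fX unfolding f by (simp add: algebra_simps)
    finally show ?thesis ..
  qed
  then have "(of_nat p * f - (f oo fps_X ^ p)) $ n / of_nat p = (W * inverse F * inverse F') $ n" for n
    using p_pos by (simp add: fps_of_nat[symmetric])
  then have "(of_nat p * f - (f oo fps_X ^ p)) $ n / of_nat p \<in> Zp" for n
    using W F F' F0 by (simp add: Zp_fpsD Zp_fps_mult Zp_fps_inverse)
  moreover have "f $ 0 = 0" by (simp add: f G_def)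
  ultimately have "fps_exp_of f \<in> Zp_fps" by (intro dieudonne_dwork)
  then show ?thesis by (simp only: f_def c_def F_def G_def)
qed

end

section \<open>Assembly over all primes\<close>

theorem theorem2:
  fixes k L :: nat and N :: "nat \<Rightarrow> nat"
  assumes "k \<ge> 1"
    and "\<And>j. j \<in> {1..k} \<Longrightarrow> N j \<ge> 1"
    and "L \<in> {1..Max (N ` {1..k})}"
  shows "\<forall>n. fps_nth (fps_rat_power (q_series L k N)
                        (of_int (Theta L) / of_nat (M_const k N))) n \<in> \<int>"
proof
  fix n
  have "Max (N ` {1..k}) \<in> N ` {1..k}"
    using assms(1) by (intro Max_in) auto
  \<comment> \<open>An index attaining the maximum: a single entry \<ge> L suffices to absorb the
    harmonic denominators.\<close>
  then obtain j where j: "j \<in> {1..k}" "L \<le> N j"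
    using assms(3) by auto
  obtain a b where ab: "quotient_of (harmonic_rat L) = (a, b)" by force
  then have "harmonic_rat L = of_int a / of_int b" "b > 0"
    by (rule quotient_of_div, rule quotient_of_denom_pos)
  moreover have "Theta L = b" by (simp add: Theta_def ab)
  ultimately have \<Theta>H: "of_int (Theta L) * harmonic_rat L = of_int a" by simp
  have power: "fps_rat_power (q_series L k N) c = fps_exp_of (fps_const c * (G_series L k N / F_series k N))" for c
    unfolding fps_rat_power_def q_series_def by (subst fps_log_of_exp_of) (simp_all add: G_div_F)
  show "fps_rat_power (q_series L k N) (of_int (Theta L) / of_nat (M_const k N)) $ n \<in> \<int>"
  proof (rule Ints_if_Zp_all)
    fix p :: nat
    assume "prime p"
    then interpret localization p by unfold_locales
    have "of_int (Theta L) * harmonic_rat L \<in> Zp"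
      unfolding \<Theta>H by (rule Zp_of_int)
    then show "fps_rat_power (q_series L k N) (of_int (Theta L) / of_nat (M_const k N)) $ n \<in> localization.Zp p"
      unfolding power by (intro Zp_fpsD exp_G_div_F_Zp[where N = N, OF Zp_of_int _ j])
  qed
qed

end
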